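(* Let $\tfrac12<\lambda<1$, let $T_\lambda\subset\mathbb{R}^2$ be the graph of the Takagi function with parameter $\lambda$, and let $\nu=(\mathrm{Id},T_\lambda)_*\mathcal{L}^1$ be the Lebesgue measure $\mathcal{L}^1$ on $[0,1]$ lifted to the graph $T_\lambda$. Let $\dim_{\mathrm{loc}}$ denote either the lower pointwise dimension $\underline{\dim}_{\mathrm{loc}}$ or the upper pointwise dimension $\overline{\dim}_{\mathrm{loc}}$ (the statement holds for each of the two choices). Then $$\max_{x\in T_\lambda,\ V\in\mathbb{RP}^1}\dim_{\mathrm H}(T_\lambda\cap(V+x))=1-\frac{\log\lambda}{\log\frac12}$$ if and only if $$\dim_{\mathrm{loc}}\bigl((\mathrm{proj}_t)_*\nu,\mathrm{proj}_t(x)\bigr)\ge1$$ for all $x\in T_\lambda$ and all $t\in\mathbb{R}$.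
   Context: For $\tfrac12<\lambda<1$ the Takagi function is $T_\lambda\colon[0,1]\to\mathbb{R}$, $T_\lambda(x)=\sum_{n=0}^\infty\lambda^n\,\mathrm{dist}(2^nx,\mathbb{Z})$. The same symbol $T_\lambda$ denotes its graph $\{(x,T_\lambda(x)):x\in[0,1]\}\subset\mathbb{R}^2$. $\mathbb{RP}^1$ is the set of all lines through the origin in $\mathbb{R}^2$. For $t\in\mathbb{R}$, $\mathrm{proj}_t\colon\mathbb{R}^2\to\mathbb{R}$ is $\mathrm{proj}_t(x_1,x_2)=(x_1,x_2)\cdot(t,1)=tx_1+x_2$. $f_*\mu$ is the pushforward of a measure $\mu$ under $f$; here $(\mathrm{Id},T_\lambda)$ is the map $x\mapsto(x,T_\lambda(x))$. $\dim_{\mathrm H}$ is the Hausdorff dimension. The lower and upper pointwise dimensions of a Borel measure $\mu$ at $x$ are $\underline{\dim}_{\mathrm{loc}}(\mu,x)=\liminf_{r\downarrow0}\frac{\log\mu(B(x,r))}{\log r}$ and $\overline{\dim}_{\mathrm{loc}}(\mu,x)=\limsup_{r\downarrow0}\frac{\log\mu(B(x,r))}{\log r}$. *)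

theory Defs
  imports "HOL-Analysis.Analysis"
begin

definition takagi :: "real \<Rightarrow> real \<Rightarrow> real" where
  "takagi lam x = (\<Sum>n. lam ^ n * infdist (2 ^ n * x) \<int>)"

definition takagi_graph :: "real \<Rightarrow> (real \<times> real) set" where
  "takagi_graph lam = {(x, takagi lam x) | x. x \<in> {0..1}}"

definition takagi_measure :: "real \<Rightarrow> (real \<times> real) measure" where
  "takagi_measure lam = distr (lebesgue_on {0..1}) borel (\<lambda>x. (x, takagi lam x))"

definition RP1 :: "(real \<times> real) set set" where
  "RP1 = {V. subspace V \<and> dim V = 1}"

definition proj :: "real \<Rightarrow> real \<times> real \<Rightarrow> real" where
  "proj t x = x \<bullet> (t, 1)"

(* The s-th power of the diameter, with the conventions that the empty set contributes 0 and
   that 0 to the power 0 is 1 for nonempty sets (whereas 0 powr 0 = 0), so that s = 0 yields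
   the counting measure. *)
definition diam_power :: "real \<Rightarrow> 'a::metric_space set \<Rightarrow> ennreal" where
  "diam_power s U = (if U = {} then 0 else if s = 0 then 1 else ennreal (diameter U powr s))"

(* Boundedness is required separately because diameter is unspecified on unbounded sets.
   Finite covers are included, padded with empty sets. *)
definition hausdorff_pre_measure :: "real \<Rightarrow> real \<Rightarrow> 'a::metric_space set \<Rightarrow> ennreal" where
  "hausdorff_pre_measure s \<delta> A =
     (INF U \<in> {U :: nat \<Rightarrow> 'a set. A \<subseteq> (\<Union>i. U i) \<and> (\<forall>i. bounded (U i) \<and> diameter (U i) \<le> \<delta>)}.
        \<Sum>i. diam_power s (U i))"

definition hausdorff_measure :: "real \<Rightarrow> 'a::metric_space set \<Rightarrow> ennreal" where
  "hausdorff_measure s A = (SUP \<delta> \<in> {0<..}. hausdorff_pre_measure s \<delta> A)"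

definition hausdorff_dim :: "'a::metric_space set \<Rightarrow> ereal" where
  "hausdorff_dim A = (INF s \<in> {s. 0 \<le> s \<and> hausdorff_measure s A = 0}. ereal s)"

(* Extended logarithm; the real ln has ln 0 = 0, which would give balls of measure zero the
   ratio 0 instead of infinity in the pointwise dimensions below. *)
definition eln :: "ennreal \<Rightarrow> ereal" where
  "eln m = (if m = 0 then -\<infinity> else if m = \<infinity> then \<infinity> else ereal (ln (enn2real m)))"

definition lower_local_dim :: "'a::metric_space measure \<Rightarrow> 'a \<Rightarrow> ereal" where
  "lower_local_dim \<mu> x = Liminf (at_right 0) (\<lambda>r. eln (emeasure \<mu> (cball x r)) / ereal (ln r))"

definition upper_local_dim :: "'a::metric_space measure \<Rightarrow> 'a \<Rightarrow> ereal" where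
  "upper_local_dim \<mu> x = Limsup (at_right 0) (\<lambda>r. eln (emeasure \<mu> (cball x r)) / ereal (ln r))"

definition is_maximum :: "'a::order \<Rightarrow> 'a set \<Rightarrow> bool" where
  "is_maximum m S \<longleftrightarrow> m \<in> S \<and> (\<forall>s\<in>S. s \<le> m)"

end

theory Submission
  imports Defs
begin

text \<open>
  Write \<open>f\<^sub>t(x) = T(x) + t x\<close> (\<open>tilt\<close> below). The non-vertical slices of the graph are the level sets
  of the functions \<open>f\<^sub>t\<close>, and the projection of the length measure is the image of Lebesgue measure
  under \<open>f\<^sub>t\<close>. Both sides of the equivalence are therefore statements about one quantity, the number
  \<open>N(t, c, n)\<close> of dyadic intervals of length \<open>2\<^sup>-\<^sup>n\<close> on which \<open>f\<^sub>t\<close> takes the value \<open>c\<close>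
  (the cardinality of \<open>hits t {c} n\<close>).

  On a dyadic interval of length \<open>2\<^sup>-\<^sup>n\<close> the function \<open>f\<^sub>t\<close> is a copy of some \<open>f\<^sub>t\<^sub>'\<close>, with heights scaled
  by \<open>lam\<^sup>n\<close> and \<open>t'\<close> confined to a bounded range (\<open>tilt_renormalize\<close>). Hence every such piece
  oscillates by an amount comparable to \<open>lam\<^sup>n\<close>. This makes the projected measure of the ball of
  radius \<open>lam\<^sup>n\<close> about \<open>c\<close> comparable to \<open>2\<^sup>-\<^sup>n N\<close>, with \<open>N\<close> taken at a few values near \<open>c\<close>. A decay
  of the measure like \<open>r powr \<kappa>\<close> with \<open>\<kappa>\<close> close to 1 thus means that \<open>N\<close> grows at most like
  \<open>2 powr (\<sigma> n)\<close> with \<open>\<sigma>\<close> close to the exponent \<open>d\<close> given by \<open>2 powr d = 2 lam\<close>, which is the number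
  \<open>1 - ln lam / ln (1/2)\<close>. The \<open>2\<^sup>n\<close> pieces have to share a range of heights of bounded length, so
  \<open>N\<close> cannot grow with an exponent smaller than \<open>d\<close> for all \<open>c\<close> at once.

  If the upper pointwise dimension at \<open>c\<close> is at least 1, then \<open>N\<close> intervals of length \<open>2\<^sup>-\<^sup>n\<close> cover the
  slice for infinitely many \<open>n\<close> with \<open>N\<close> small, and the slice has dimension at most \<open>d\<close>
  (\<open>hausdorff_dim_slice_le_typical_dim\<close>).

  The other implication has to turn information on each individual slice into a bound for \<open>N\<close> that is
  uniform in \<open>c\<close> and \<open>n\<close>. This is \<open>card_hits_growth\<close>: if all slices have dimension less than \<open>\<sigma>\<close>,
  each has a finite dyadic cover with small \<open>\<sigma>\<close>-sum. The cover still works for nearby slices, so by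
  compactness the covering intervals may be taken of length at least \<open>2\<^sup>-\<^sup>L\<close> for a common \<open>L\<close>. The
  part of a slice in a dyadic interval is again a slice after rescaling, so the covers can be
  iterated, and \<open>N\<close> grows with an exponent strictly below \<open>\<sigma>\<close>. Applied with \<open>\<sigma> > d\<close> this gives the
  lower bound for the lower pointwise dimension; applied with \<open>\<sigma> = d\<close> it contradicts the
  minimal growth of \<open>N\<close>, which shows that some slice has dimension at least \<open>d\<close> and that the maximum
  is attained. The bound is derived for the lower pointwise dimension and used only for the upper one,
  so both versions of the theorem follow together.
\<close>

section \<open>The Takagi function and its tilts\<close>

lemma infdist_Ints_le_1: "infdist (x::real) \<int> \<le> 1"
proof -
  have "infdist x \<int> \<le> dist x (of_int \<lfloor>x\<rfloor>)"
    by (rule infdist_le) simp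
  also have "\<dots> \<le> 1"
    by (simp add: dist_real_def) linarith
  finally show ?thesis .
qed

lemma infdist_Ints_add_1: "infdist (x + 1) \<int> = infdist (x::real) \<int>"
proof -
  have le: "infdist (y + of_int m) \<int> \<le> infdist y \<int>" for y :: real and m :: int
  proof -
    have ne: "(\<int>::real set) \<noteq> {}" by auto
    have "infdist (y + of_int m) \<int> \<le> dist y a" if "a \<in> \<int>" for a
    proof -
      have "infdist (y + of_int m) \<int> \<le> dist (y + of_int m) (a + of_int m)"
        using that by (intro infdist_le) auto
      then show ?thesis by simp
    qed
    then show ?thesis
      unfolding infdist_notempty[OF ne, of y] by (intro cINF_greatest ne) auto
  qed
  show ?thesis
    using le[of x 1] le[of "x + 1" "-1"] by simp
qed

lemma infdist_Ints_unit:
  assumes "0 \<le> x" "x \<le> (1::real)"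
  shows "infdist x \<int> = min x (1 - x)"
proof (rule antisym)
  have "infdist x \<int> \<le> dist x 0" "infdist x \<int> \<le> dist x 1"
    by (rule infdist_le; simp)+
  then show "infdist x \<int> \<le> min x (1 - x)"
    using assms by (auto simp: dist_real_def)
  have ne: "(\<int>::real set) \<noteq> {}" by auto
  have "min x (1 - x) \<le> dist x a" if a: "a \<in> \<int>" for a
  proof -
    obtain m :: int where m: "a = of_int m" using a by (auto elim: Ints_cases)
    show ?thesis
    proof (cases "m \<le> 0")
      case True
      then have "a \<le> 0" using m by simp
      then show ?thesis using assms by (auto simp: dist_real_def min_def)
    next
      case False
      then have "1 \<le> a" using m by simp
      then show ?thesis using assms by (auto simp: dist_real_def min_def)
    qed
  qed
  then show "min x (1 - x) \<le> infdist x \<int>"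
    unfolding infdist_notempty[OF ne] by (intro cINF_greatest ne)
qed

locale takagi_parameter =
  fixes lam :: real
  assumes lam_gt_half: "1 / 2 < lam" and lam_less_1: "lam < 1"
begin

lemma lam_pos [simp]: "0 < lam" and lam_nonneg [simp]: "0 \<le> lam"
  using lam_gt_half by auto

lemma lam_neq_0 [simp]: "lam \<noteq> 0"
  using lam_pos by linarith

lemma takagi_term_bound: "norm (lam ^ n * infdist (2 ^ n * (x::real)) \<int>) \<le> lam ^ n"
proof -
  have "lam ^ n * infdist (2 ^ n * x) \<int> \<le> lam ^ n * 1"
    by (intro mult_left_mono infdist_Ints_le_1) auto
  then show ?thesis by (simp add: abs_mult infdist_nonneg)
qed

lemma summable_takagi: "summable (\<lambda>n. lam ^ n * infdist (2 ^ n * (x::real)) \<int>)"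
  by (rule summable_comparison_test'[where g = "\<lambda>n. lam ^ n" and N = 0])
     (use lam_less_1 takagi_term_bound in \<open>auto intro: summable_geometric\<close>)

lemma takagi_step: "takagi lam x = infdist x \<int> + lam * takagi lam (2 * x)"
proof -
  have "takagi lam x = infdist x \<int> + (\<Sum>n. lam * (lam ^ n * infdist (2 ^ n * (2 * x)) \<int>))"
    unfolding takagi_def using suminf_split_head[OF summable_takagi[of x]]
    by (simp add: algebra_simps)
  also have "(\<Sum>n. lam * (lam ^ n * infdist (2 ^ n * (2 * x)) \<int>)) = lam * takagi lam (2 * x)"
    unfolding takagi_def by (rule suminf_mult[OF summable_takagi])
  finally show ?thesis .
qed

lemma takagi_add_1: "takagi lam (x + 1) = takagi lam x"
proof -
  have "infdist (2 ^ n * (x + 1)) \<int> = infdist (2 ^ n * x) \<int>" for n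
  proof -
    have "infdist (y + real m) \<int> = infdist y \<int>" for y m
      by (induction m) (simp_all add: add.assoc[symmetric] infdist_Ints_add_1 flip: add.commute[of _ 1])
    from this[of "2 ^ n * x" "2 ^ n"] show ?thesis by (simp add: algebra_simps)
  qed
  then show ?thesis by (simp add: takagi_def)
qed

lemma takagi_left_half: 
  assumes "u \<in> {0..1}"
  shows "takagi lam (u / 2) = u / 2 + lam * takagi lam u"
  using assms takagi_step[of "u / 2"] by (simp add: infdist_Ints_unit min_def)

lemma takagi_right_half: 
  assumes "u \<in> {0..1}"
  shows "takagi lam ((1 + u) / 2) = (1 - u) / 2 + lam * takagi lam u"
proof -
  have "infdist ((1 + u) / 2) \<int> = (1 - u) / 2"
    using assms by (simp add: infdist_Ints_unit min_def field_simps)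
  moreover have "2 * ((1 + u) / 2) = u + 1"
    by (simp add: field_simps)
  ultimately show ?thesis
    using takagi_step[of "(1 + u) / 2"] takagi_add_1[of u] by metis
qed

lemma takagi_0: "takagi lam 0 = 0"
  by (simp add: takagi_def)

lemma takagi_1: "takagi lam 1 = 0"
  using takagi_add_1[of 0] takagi_0 by simp

lemma takagi_half: "takagi lam (1 / 2) = 1 / 2"
  using takagi_left_half[of 1] takagi_1 by simp

lemma takagi_nonneg: "0 \<le> takagi lam x"
  unfolding takagi_def by (intro suminf_nonneg summable_takagi) (simp add: infdist_nonneg)

lemma takagi_le: "takagi lam x \<le> 1 / (1 - lam)"
proof -
  have "takagi lam x \<le> (\<Sum>n. lam ^ n)"
    unfolding takagi_def
    using abs_le_D1[OF takagi_term_bound[of _ x, unfolded real_norm_def]] lam_less_1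
    by (intro suminf_le summable_takagi summable_geometric) auto
  then show ?thesis using lam_less_1 by (simp add: suminf_geometric)
qed

lemma continuous_on_takagi: "continuous_on A (takagi lam)"
proof -
  have "uniform_limit UNIV (\<lambda>n x::real. \<Sum>i<n. lam ^ i * infdist (2 ^ i * x) \<int>)
      (\<lambda>x. \<Sum>i. lam ^ i * infdist (2 ^ i * x) \<int>) sequentially"
    using takagi_term_bound lam_less_1
    by (intro Weierstrass_m_test[where M = "\<lambda>n. lam ^ n"]) (auto intro: summable_geometric)
  then have "continuous_on UNIV (\<lambda>x::real. \<Sum>i. lam ^ i * infdist (2 ^ i * x) \<int>)"
    by (rule uniform_limit_theorem[rotated])
       (auto intro!: always_eventually continuous_intros)
  then show ?thesis
    unfolding takagi_def[abs_def] by (rule continuous_on_subset) simp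
qed

definition tilt :: "real \<Rightarrow> real \<Rightarrow> real" where
  "tilt t x = takagi lam x + t * x"

lemma continuous_on_tilt: "continuous_on A (tilt t)"
  unfolding tilt_def[abs_def] by (intro continuous_intros continuous_on_takagi)

text \<open>
  One halving step turns the slope \<open>t\<close> into \<open>(t + 1) / (2 * lam)\<close> or \<open>(t - 1) / (2 * lam)\<close>, because the
  two halves of the graph are affine images of the graph, sheared with slopes 1 and -1. As
  \<open>2 * lam > 1\<close>, these maps contract, and they preserve the interval from \<open>- R\<close> to \<open>R\<close> as soon as
  \<open>R \<ge> 1 / (2 * lam - 1)\<close>. The invariance of a compact range of slopes is what makes the
  compactness argument for slices possible.
\<close>

lemma tilt_renormalize:
  assumes R: "1 / (2 * lam - 1) \<le> R" and t: "\<bar>t\<bar> \<le> R" and k: "k < 2 ^ l"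
  obtains t' b where "\<bar>t'\<bar> \<le> R"
    "\<And>u. u \<in> {0..1} \<Longrightarrow> tilt t ((real k + u) / 2 ^ l) = lam ^ l * tilt t' u + b"
proof -
  have R1: "R + 1 \<le> 2 * lam * R"
    using R lam_gt_half by (simp add: field_simps)
  have "\<exists>t' b. \<bar>t'\<bar> \<le> R \<and> 
      (\<forall>u\<in>{0..1}. tilt t ((real k + u) / 2 ^ l) = lam ^ l * tilt t' u + b)"
    using k
  proof (induction l arbitrary: k)
    case 0
    then show ?case using t by (intro exI[of _ t] exI[of _ 0]) auto
  next
    case (Suc l)
    define j where "j = k div 2"
    have "j < 2 ^ l" using Suc.prems by (auto simp: j_def)
    then obtain t' b where t': "\<bar>t'\<bar> \<le> R" and
      b: "\<And>u. u \<in> {0..1} \<Longrightarrow> tilt t ((real j + u) / 2 ^ l) = lam ^ l * tilt t' u + b"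
      using Suc.IH by meson
    have new: "\<bar>(t' + e) / (2 * lam)\<bar> \<le> R" if "\<bar>e\<bar> = 1" for e
    proof -
      have "\<bar>t' + e\<bar> \<le> 2 * lam * R" using that t' R1 by linarith
      then show ?thesis by (simp add: abs_divide abs_mult field_simps)
    qed
    consider "k = 2 * j" | "k = 2 * j + 1" unfolding j_def by linarith
    then show ?case
    proof cases
      case 1
      have "tilt t ((real k + u) / 2 ^ Suc l) = lam ^ Suc l * tilt ((t' + 1) / (2 * lam)) u + b" 
        if u: "u \<in> {0..1}" for u
      proof -
        have "(real k + u) / 2 ^ Suc l = (real j + u / 2) / 2 ^ l"
          using 1 by (simp add: field_simps)
        then have "tilt t ((real k + u) / 2 ^ Suc l) = lam ^ l * tilt t' (u / 2) + b"
          using b[of "u / 2"] u by simp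
        also have "tilt t' (u / 2) = lam * tilt ((t' + 1) / (2 * lam)) u"
          unfolding tilt_def takagi_left_half[OF u]
          using lam_pos by (simp add: field_simps del: lam_pos)
        finally show ?thesis by simp
      qed
      then show ?thesis using new[of 1] by (meson abs_one)
    next
      case 2
      have "tilt t ((real k + u) / 2 ^ Suc l) = 
          lam ^ Suc l * tilt ((t' + -1) / (2 * lam)) u + (lam ^ l * (1 + t') / 2 + b)" 
        if u: "u \<in> {0..1}" for u
      proof -
        have "(real k + u) / 2 ^ Suc l = (real j + (1 + u) / 2) / 2 ^ l"
          using 2 by (simp add: field_simps)
        then have "tilt t ((real k + u) / 2 ^ Suc l) = lam ^ l * tilt t' ((1 + u) / 2) + b"
          using b[of "(1 + u) / 2"] u by simp
        also have "tilt t' ((1 + u) / 2) = 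
            lam * tilt ((t' + -1) / (2 * lam)) u + (1 + t') / 2"
          unfolding tilt_def takagi_right_half[OF u]
          using lam_pos by (simp add: field_simps del: lam_pos)
        finally show ?thesis by (simp add: algebra_simps)
      qed
      then show ?thesis using new[of "-1"] by (metis abs_minus_cancel abs_one)
    qed
  qed
  then show ?thesis using that by blast
qed

text \<open>
  A linear term does not change the second difference over 0, 1/2, 1, which for the Takagi function
  equals -1. So no slope can flatten the graph, and the bound is uniform in \<open>t\<close>.
\<close>

lemma tilt_swing:
  obtains u v where "u \<in> {0..1}" "v \<in> {0..1}" "tilt t u + 1 / 2 \<le> tilt t v"
proof -
  have "tilt t 0 = 0" "tilt t (1 / 2) = 1 / 2 + t / 2" "tilt t 1 = t"
    by (simp_all add: tilt_def takagi_0 takagi_half takagi_1)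
  then have "tilt t 0 + 1 / 2 \<le> tilt t (1 / 2) \<or> tilt t 1 + 1 / 2 \<le> tilt t (1 / 2)"
    by linarith
  then show ?thesis
    using that[of 0 "1 / 2"] that[of 1 "1 / 2"] by auto
qed

end

section \<open>Counting dyadic intervals that meet a level\<close>

definition dyadic :: "nat \<Rightarrow> nat \<Rightarrow> real set" where
  "dyadic n k = (\<lambda>u. (real k + u) / 2 ^ n) ` {0..1}"

lemma dyadic_eq: "dyadic n k = {real k / 2 ^ n .. (real k + 1) / 2 ^ n}"
proof
  show "dyadic n k \<subseteq> {real k / 2 ^ n .. (real k + 1) / 2 ^ n}"
    by (auto simp: dyadic_def divide_right_mono)
  show "{real k / 2 ^ n .. (real k + 1) / 2 ^ n} \<subseteq> dyadic n k"
    unfolding dyadic_def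
    by (auto intro!: image_eqI[where x = "2 ^ n * x - real k" for x] simp: field_simps)
qed

lemma dyadic_subset_unit: "k < 2 ^ n \<Longrightarrow> dyadic n k \<subseteq> {0..1}"
proof -
  assume "k < 2 ^ n"
  then have "real (k + 1) \<le> real (2 ^ n)" by (subst of_nat_le_iff) simp
  then show ?thesis by (auto simp: dyadic_eq field_simps elim!: order_trans)
qed

lemma unit_in_dyadic:
  assumes "x \<in> {0..1}"
  obtains k where "k < 2 ^ n" "x \<in> dyadic n k"
proof (cases "x = 1")
  case True
  have "x \<in> dyadic n (2 ^ n - 1)"
    using True by (simp add: dyadic_eq field_simps of_nat_diff)
  then show ?thesis using that[of "2 ^ n - 1"] by simp
next
  case False
  define k where "k = nat \<lfloor>2 ^ n * x\<rfloor>"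
  have k: "real k \<le> 2 ^ n * x" "2 ^ n * x < real k + 1"
    using assms by (auto simp: k_def)
  have "2 ^ n * x < 2 ^ n" using False assms by simp
  then have "real k < 2 ^ n" using k by linarith
  then have "k < 2 ^ n" by simp
  moreover have "x \<in> dyadic n k" using k by (simp add: dyadic_eq field_simps)
  ultimately show ?thesis using that by blast
qed

lemma dyadic_child:
  assumes "i < 2 ^ n" "l \<le> n" 
  defines "k \<equiv> i div 2 ^ (n - l)" and "j \<equiv> i mod 2 ^ (n - l)"
  shows "k < 2 ^ l" "j < 2 ^ (n - l)"
    "(real i + u) / 2 ^ n = (real k + (real j + u) / 2 ^ (n - l)) / 2 ^ l"
proof -
  have split: "(2::'a::comm_semiring_1) ^ n = 2 ^ l * 2 ^ (n - l)"
    using assms(2) by (simp flip: power_add)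
  show "k < 2 ^ l" 
    using assms(1) unfolding k_def split by (simp add: less_mult_imp_div_less)
  show "j < 2 ^ (n - l)" by (simp add: j_def)
  have "i = k * 2 ^ (n - l) + j"
    unfolding k_def j_def by (simp only: div_mult_mod_eq)
  then have "real i = real k * 2 ^ (n - l) + real j"
    by simp
  then show "(real i + u) / 2 ^ n = (real k + (real j + u) / 2 ^ (n - l)) / 2 ^ l"
    unfolding split by (simp add: field_simps)
qed

lemma card_dyadic_meeting_ball:
  "finite {k. dyadic l k \<inter> ball p (1 / 2 ^ l) \<noteq> {}}"
  "card {k. dyadic l k \<inter> ball p (1 / 2 ^ l) \<noteq> {}} \<le> 4"
proof -
  let ?K = "{k. dyadic l k \<inter> ball p (1 / 2 ^ l) \<noteq> {}}"
  let ?m = "\<lfloor>2 ^ l * p\<rfloor>"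
  have "int ` ?K \<subseteq> {?m - 2..?m + 1}"
  proof
    fix z assume "z \<in> int ` ?K"
    then obtain k x where k: "z = int k" "x \<in> dyadic l k" "\<bar>p - x\<bar> < 1 / 2 ^ l" 
      unfolding dist_real_def ball_def by blast
    have "\<bar>2 ^ l * p - 2 ^ l * x\<bar> < 1"
    proof -
      have "\<bar>2 ^ l * p - 2 ^ l * x\<bar> = 2 ^ l * \<bar>p - x\<bar>"
        unfolding right_diff_distrib[symmetric] by (simp add: abs_mult)
      also have "\<dots> < 1" using k(3) by (simp add: field_simps)
      finally show ?thesis .
    qed
    moreover have "real k \<le> 2 ^ l * x" "2 ^ l * x \<le> real k + 1"
      using k(2) by (auto simp: dyadic_eq field_simps)
    ultimately have "of_int z < 2 ^ l * p + 1" "2 ^ l * p - 2 < of_int z"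
      using k(1) by auto
    then show "z \<in> {?m - 2..?m + 1}" by simp linarith
  qed
  note sub = this
  have "finite (int ` ?K)" by (rule finite_subset[OF sub]) simp
  moreover have "card (int ` ?K) \<le> card {?m - 2..?m + 1}"
    by (rule card_mono[OF _ sub]) simp
  ultimately show "finite ?K" "card ?K \<le> 4"
    by (auto simp: card_image finite_image_iff)
qed

context takagi_parameter
begin

definition hits :: "real \<Rightarrow> real set \<Rightarrow> nat \<Rightarrow> nat set" where
  "hits t A n = {k. k < 2 ^ n \<and> tilt t ` dyadic n k \<inter> A \<noteq> {}}"

lemma finite_hits [simp]: "finite (hits t A n)"
  by (simp add: hits_def)

lemma card_hits_le: "card (hits t A n) \<le> 2 ^ n"
proof -
  have "card (hits t A n) \<le> card {..<2 ^ n :: nat}"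
    by (rule card_mono) (auto simp: hits_def)
  then show ?thesis by simp
qed

lemma tilt_dyadic_oscillation_le:
  assumes R: "1 / (2 * lam - 1) \<le> R" "\<bar>t\<bar> \<le> R" and k: "k < 2 ^ n"
    and x: "x \<in> dyadic n k" "y \<in> dyadic n k"
  shows "\<bar>tilt t x - tilt t y\<bar> \<le> lam ^ n * (1 / (1 - lam) + R)"
proof -
  obtain t' b where t': "\<bar>t'\<bar> \<le> R" and
    b: "\<And>u. u \<in> {0..1} \<Longrightarrow> tilt t ((real k + u) / 2 ^ n) = lam ^ n * tilt t' u + b"
    using tilt_renormalize[OF R k] by blast
  obtain u v where u: "u \<in> {0..1}" "x = (real k + u) / 2 ^ n"
    and v: "v \<in> {0..1}" "y = (real k + v) / 2 ^ n"
    using x by (auto simp: dyadic_def)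
  have "tilt t x - tilt t y = lam ^ n * (tilt t' u - tilt t' v)"
    using u v b by (simp add: algebra_simps)
  moreover have "\<bar>tilt t' u - tilt t' v\<bar> \<le> 1 / (1 - lam) + R"
  proof -
    have "\<bar>t' * (u - v)\<bar> \<le> R * 1"
      unfolding abs_mult using t' u v by (intro mult_mono) auto
    moreover have "tilt t' u - tilt t' v = takagi lam u - takagi lam v + t' * (u - v)"
      by (simp add: tilt_def algebra_simps)
    ultimately show ?thesis
      using takagi_nonneg[of u] takagi_nonneg[of v] takagi_le[of u] takagi_le[of v] by linarith
  qed
  ultimately show ?thesis
    by (simp add: abs_mult mult_left_mono)
qed

lemma is_interval_tilt_dyadic: "is_interval (tilt t ` dyadic n k)"
  unfolding is_interval_connected_1 dyadic_eq
  by (intro connected_continuous_image continuous_on_tilt) simp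

lemma tilt_dyadic_oscillation_ge:
  assumes k: "k < 2 ^ n"
  obtains p q where "p \<in> tilt t ` dyadic n k" "q \<in> tilt t ` dyadic n k" "p + lam ^ n / 2 \<le> q"
proof -
  define R where "R = max \<bar>t\<bar> (1 / (2 * lam - 1))"
  obtain t' b where
    b: "\<And>u. u \<in> {0..1} \<Longrightarrow> tilt t ((real k + u) / 2 ^ n) = lam ^ n * tilt t' u + b"
    using tilt_renormalize[of R t k n] k unfolding R_def by (metis max.cobounded1 max.cobounded2)
  obtain u v where uv: "u \<in> {0..1}" "v \<in> {0..1}" "tilt t' u + 1 / 2 \<le> tilt t' v"
    using tilt_swing by blast
  have "lam ^ n * (tilt t' u + 1 / 2) \<le> lam ^ n * tilt t' v"
    using uv by (intro mult_left_mono) auto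
  then have "tilt t ((real k + u) / 2 ^ n) + lam ^ n / 2 \<le> tilt t ((real k + v) / 2 ^ n)"
    using b uv by (simp add: distrib_left)
  moreover have "(real k + u) / 2 ^ n \<in> dyadic n k" "(real k + v) / 2 ^ n \<in> dyadic n k"
    using uv by (auto simp: dyadic_def)
  ultimately show ?thesis using that by blast
qed

text \<open>
  The image of each dyadic interval is an interval of length at least \<open>lam ^ n / 2\<close>, so one that meets
  \<open>{a..b}\<close> contains a point of the grid of that mesh, at most one step below \<open>a\<close> or above \<open>b\<close>.
  This transfers bounds for single levels to bounds for intervals of levels.
\<close>

lemma card_hits_interval_le:
  assumes M: "\<And>c. real (card (hits t {c} n)) \<le> M" and ab: "a \<le> b"
  shows "real (card (hits t {a..b} n)) \<le> (2 * (b - a) / lam ^ n + 3) * M"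
proof -
  define h where "h = lam ^ n / 2"
  have h: "0 < h" by (simp add: h_def)
  define m where "m = \<lceil>(b - a) / h\<rceil>"
  have "hits t {a..b} n \<subseteq> (\<Union>j\<in>{-1..m}. hits t {a + of_int j * h} n)"
  proof
    fix k assume "k \<in> hits t {a..b} n"
    then obtain y where k: "k < 2 ^ n" and y: "y \<in> tilt t ` dyadic n k" "a \<le> y" "y \<le> b"
      unfolding hits_def by (metis (mono_tags, lifting) IntE atLeastAtMost_iff ex_in_conv mem_Collect_eq)
    obtain p0 q0 where pq0: "p0 \<in> tilt t ` dyadic n k" "q0 \<in> tilt t ` dyadic n k" "p0 + h \<le> q0"
      using tilt_dyadic_oscillation_ge[OF k] unfolding h_def by blast
    \<comment> \<open>enlarge the subinterval so that it contains \<open>y\<close>, then cut it to length \<open>h\<close> around \<open>y\<close>\<close>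
    define p q where "p = min p0 y" and "q = max q0 y"
    have pq: "p \<in> tilt t ` dyadic n k" "q \<in> tilt t ` dyadic n k" "p + h \<le> q" "p \<le> y" "y \<le> q"
      using pq0 y by (auto simp: p_def q_def min_def max_def)
    define p' where "p' = max p (y - h)"
    have p': "p' \<le> b" "a - h \<le> p'" "p \<le> p'" "p' + h \<le> q"
      using y pq h by (auto simp: p'_def)
    define j where "j = \<lceil>(p' - a) / h\<rceil>"
    have "(p' - a) / h \<le> of_int j" "of_int j < (p' - a) / h + 1"
      unfolding j_def by linarith+
    then have j: "p' \<le> a + of_int j * h" "a + of_int j * h < p' + h"
      using h by (auto simp: field_simps)
    have "a + of_int j * h \<in> tilt t ` dyadic n k"
      using j p' by (intro mem_is_interval_1_I[OF is_interval_tilt_dyadic pq(1,2)]) auto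
    then have "k \<in> hits t {a + of_int j * h} n"
      using k by (simp add: hits_def)
    moreover have "j \<in> {-1..m}"
    proof -
      have "-1 \<le> (p' - a) / h" "(p' - a) / h \<le> (b - a) / h"
        using p' h by (auto simp: field_simps)
      then show ?thesis
        using ceiling_mono[of "(p' - a) / h" "(b - a) / h"] by (simp add: j_def m_def) linarith
    qed
    ultimately show "k \<in> (\<Union>j\<in>{-1..m}. hits t {a + of_int j * h} n)" by blast
  qed
  then have "card (hits t {a..b} n) \<le> card (\<Union>j\<in>{-1..m}. hits t {a + of_int j * h} n)"
    by (intro card_mono) auto
  also have "\<dots> \<le> (\<Sum>j\<in>{-1..m}. card (hits t {a + of_int j * h} n))"
    by (rule card_UN_le) simp
  finally have "real (card (hits t {a..b} n)) \<le> (\<Sum>j\<in>{-1..m}. real (card (hits t {a + of_int j * h} n)))"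
    by (metis of_nat_le_iff of_nat_sum)
  also have "\<dots> \<le> (\<Sum>j\<in>{-1..m}. M)"
    by (intro sum_mono M)
  also have "\<dots> = real (nat (m + 2)) * M" by (simp add: add.commute)
  also have "\<dots> \<le> (2 * (b - a) / lam ^ n + 3) * M"
  proof (rule mult_right_mono)
    have "0 \<le> (b - a) / h" using ab h by simp
    then have "real (nat (m + 2)) \<le> (b - a) / h + 3"
      unfolding m_def by linarith
    moreover have "(b - a) / h = 2 * (b - a) / lam ^ n"
      by (simp add: h_def)
    ultimately show "real (nat (m + 2)) \<le> 2 * (b - a) / lam ^ n + 3"
      by simp
    show "0 \<le> M" using M[of 0] by linarith
  qed
  finally show ?thesis .
qed

text \<open>
  Pigeonhole principle: all \<open>2 ^ n\<close> dyadic pieces of the graph have their heights in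
  \<open>{0..1 / (1 - lam)}\<close>, so some level is taken on about \<open>(2 * lam) ^ n\<close> of them.
\<close>

lemma card_hits_lower_bound:
  assumes M: "\<And>c. real (card (hits 0 {c} n)) \<le> M"
  shows "2 ^ n \<le> (2 / (1 - lam) / lam ^ n + 3) * M"
proof -
  have "hits 0 {0..1 / (1 - lam)} n = {..<2 ^ n}"
  proof -
    have "tilt 0 (real k / 2 ^ n) \<in> tilt 0 ` dyadic n k \<inter> {0..1 / (1 - lam)}" for k
      using takagi_nonneg takagi_le by (auto simp: tilt_def dyadic_eq divide_right_mono)
    then show ?thesis unfolding hits_def by blast
  qed
  then show ?thesis
    using card_hits_interval_le[OF M, of 0 "1 / (1 - lam)"] lam_less_1 by simp
qed

text \<open>
  The part of a level set of \<open>tilt t\<close> in a dyadic interval of level \<open>l\<close> is a scaled copy of a level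
  set of another tilt, whose intervals of level \<open>n - l\<close> are bounded by \<open>F\<close>. The covering hypothesis
  asks for all intervals of level \<open>l\<close> that contain \<open>x\<close>: the interval of level \<open>n\<close> that is counted
  because of an endpoint \<open>x\<close> may lie on either side of \<open>x\<close>.
\<close>

lemma card_hits_le_sum_cover:
  assumes R: "1 / (2 * lam - 1) \<le> R" "\<bar>t\<bar> \<le> R"
    and W: "finite W" "\<And>l k. (l, k) \<in> W \<Longrightarrow> 1 \<le> l \<and> l \<le> n"
    and cover: "\<And>x. \<lbrakk>x \<in> {0..1}; tilt t x = c\<rbrakk> \<Longrightarrow>
        \<exists>l. \<forall>k<2 ^ l. x \<in> dyadic l k \<longrightarrow> (l, k) \<in> W"
    and F: "\<And>t' c' m. \<lbrakk>\<bar>t'\<bar> \<le> R; m < n\<rbrakk> \<Longrightarrow> real (card (hits t' {c'} m)) \<le> F m"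
  shows "real (card (hits t {c} n)) \<le> (\<Sum>(l, k)\<in>W. F (n - l))"
proof -
  define H where "H l k = {i. i < 2 ^ n \<and> i div 2 ^ (n - l) = k \<and> c \<in> tilt t ` dyadic n i}" 
    for l k
  have H: "real (card (H l k)) \<le> F (n - l)" if lk: "(l, k) \<in> W" for l k
  proof (cases "k < 2 ^ l")
    case False
    have "H l k = {}"
      using False dyadic_child(1)[of _ n l] W(2)[OF lk] by (auto simp: H_def)
    moreover have "0 \<le> F (n - l)"
      using F[OF R(2), of "n - l" 0] W(2)[OF lk] by simp
    ultimately show ?thesis by simp
  next
    case True
    obtain t' b where t': "\<bar>t'\<bar> \<le> R" and
      b: "\<And>u. u \<in> {0..1} \<Longrightarrow> tilt t ((real k + u) / 2 ^ l) = lam ^ l * tilt t' u + b"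
      using tilt_renormalize[OF R True] by blast
    let ?K = "hits t' {(c - b) / lam ^ l} (n - l)"
    have "H l k \<subseteq> (\<lambda>j. k * 2 ^ (n - l) + j) ` ?K"
    proof
      fix i assume i: "i \<in> H l k"
      then obtain u where u: "i < 2 ^ n" "i div 2 ^ (n - l) = k" "u \<in> {0..1}" 
        "tilt t ((real i + u) / 2 ^ n) = c"
        by (auto simp: H_def dyadic_def)
      define j where "j = i mod 2 ^ (n - l)"
      note child = dyadic_child[OF u(1), of l, unfolded u(2), folded j_def]
      have j: "j < 2 ^ (n - l)" using child W(2)[OF lk] by blast
      have mem: "(real j + u) / 2 ^ (n - l) \<in> dyadic (n - l) j"
        using u(3) by (auto simp: dyadic_def)
      then have "(real j + u) / 2 ^ (n - l) \<in> {0..1}"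
        using dyadic_subset_unit[OF j] by blast
      then have "c = lam ^ l * tilt t' ((real j + u) / 2 ^ (n - l)) + b"
        using b child(3)[of u] u(4) W(2)[OF lk] by auto
      then have "tilt t' ((real j + u) / 2 ^ (n - l)) = (c - b) / lam ^ l"
        using lam_pos by (simp add: field_simps del: lam_pos)
      then have "j \<in> ?K"
        using j mem unfolding hits_def by blast
      moreover have "i = k * 2 ^ (n - l) + j"
        unfolding j_def u(2)[symmetric] by (simp only: div_mult_mod_eq)
      ultimately show "i \<in> (\<lambda>j. k * 2 ^ (n - l) + j) ` ?K" by blast
    qed
    then have "card (H l k) \<le> card ?K"
      by (meson card_image_le card_mono finite_hits finite_imageI order_trans)
    also have "real (card ?K) \<le> F (n - l)"
      using W(2)[OF lk] by (intro F t') auto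
    finally show ?thesis by simp
  qed
  have "hits t {c} n \<subseteq> (\<Union>(l, k)\<in>W. H l k)"
  proof
    fix i assume "i \<in> hits t {c} n"
    then obtain u where u: "i < 2 ^ n" "u \<in> {0..1}" "tilt t ((real i + u) / 2 ^ n) = c"
      by (auto simp: hits_def dyadic_def)
    let ?x = "(real i + u) / 2 ^ n"
    have x: "?x \<in> dyadic n i" using u(2) by (auto simp: dyadic_def)
    then have x01: "?x \<in> {0..1}" using dyadic_subset_unit[OF u(1)] by blast
    obtain l where l: "\<And>k. k < 2 ^ l \<Longrightarrow> ?x \<in> dyadic l k \<Longrightarrow> (l, k) \<in> W"
      using cover[OF x01 u(3)] by blast
    obtain k0 where "k0 < 2 ^ l" "?x \<in> dyadic l k0" using unit_in_dyadic[OF x01] .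
    then have ln: "l \<le> n" using l W(2) by blast
    let ?k = "i div 2 ^ (n - l)" and ?j = "i mod 2 ^ (n - l)"
    note child = dyadic_child[OF u(1) ln]
    have "(real ?j + u) / 2 ^ (n - l) \<in> dyadic (n - l) ?j"
      using u(2) by (auto simp: dyadic_def)
    then have "(real ?j + u) / 2 ^ (n - l) \<in> {0..1}"
      using dyadic_subset_unit[OF child(2)] by blast
    then have "?x \<in> dyadic l ?k"
      unfolding child(3) by (auto simp: dyadic_def)
    then have "(l, ?k) \<in> W" using l child(1) by blast
    moreover have "i \<in> H l ?k" using u x by (auto simp: H_def)
    ultimately show "i \<in> (\<Union>(l, k)\<in>W. H l k)" by blast
  qed
  then have "card (hits t {c} n) \<le> card (\<Union>(l, k)\<in>W. H l k)"
    using W(1) by (intro card_mono) (auto simp: H_def)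
  also have "\<dots> \<le> (\<Sum>(l, k)\<in>W. card (H l k))"
    using card_UN_le[OF W(1), of "\<lambda>(l, k). H l k"] by (simp add: case_prod_unfold)
  also have "real \<dots> \<le> (\<Sum>(l, k)\<in>W. F (n - l))"
    unfolding of_nat_sum using H by (intro sum_mono) auto
  finally show ?thesis by simp
qed

end

section \<open>Hausdorff measure and covers\<close>

lemma hausdorff_dim_leI:
  assumes "0 \<le> s" "hausdorff_measure s A = 0"
  shows "hausdorff_dim A \<le> ereal s"
  unfolding hausdorff_dim_def using assms by (intro INF_lower) auto

lemma hausdorff_dim_lessE:
  assumes "hausdorff_dim A < ereal \<sigma>"
  obtains s where "0 \<le> s" "s < \<sigma>" "hausdorff_measure s A = 0"
  using assms unfolding hausdorff_dim_def INF_less_iff by auto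

lemma hausdorff_null_cover:
  fixes A :: "'a::metric_space set"
  assumes "hausdorff_measure s A = 0" "0 < \<delta>" "0 < \<eta>"
  obtains U :: "nat \<Rightarrow> 'a set" where "A \<subseteq> (\<Union>i. U i)"
    "\<And>i. bounded (U i)" "\<And>i. diameter (U i) \<le> \<delta>" "(\<Sum>i. diam_power s (U i)) < ennreal \<eta>"
proof -
  have "hausdorff_pre_measure s \<delta> A \<le> hausdorff_measure s A"
    unfolding hausdorff_measure_def using assms(2) by (intro SUP_upper) auto
  also have "\<dots> < ennreal \<eta>" using assms by simp
  finally show ?thesis
    unfolding hausdorff_pre_measure_def INF_less_iff using that by auto
qed

lemma hausdorff_pre_measure_le_finite:
  assumes "A \<subseteq> (\<Union>k\<in>K. U k)" "finite K" "0 < s"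
    and U: "\<And>k. k \<in> K \<Longrightarrow> bounded (U k) \<and> diameter (U k) \<le> d" and d: "d \<le> \<delta>" "0 \<le> d"
  shows "hausdorff_pre_measure s \<delta> A \<le> ennreal (real (card K) * d powr s)"
proof -
  obtain f where f: "bij_betw f {..<card K} K"
    using ex_bij_betw_nat_finite[OF assms(2)] by (auto simp: atLeast0LessThan)
  define V where "V i = (if i < card K then U (f i) else {})" for i
  have fK: "f i \<in> K" if "i < card K" for i
    using bij_betwE[OF f] that by blast
  have "A \<subseteq> (\<Union>i. V i)"
  proof
    fix x assume "x \<in> A"
    then obtain k where k: "k \<in> K" "x \<in> U k" using assms(1) by blast
    then obtain i where "i < card K" "f i = k"
      using f unfolding bij_betw_def by (metis imageE lessThan_iff)
    then show "x \<in> (\<Union>i. V i)" using k by (auto simp: V_def)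
  qed
  moreover have "bounded (V i) \<and> diameter (V i) \<le> \<delta>" for i
    using U[OF fK, of i] d by (auto simp: V_def)
  ultimately have "hausdorff_pre_measure s \<delta> A \<le> (\<Sum>i. diam_power s (V i))"
    unfolding hausdorff_pre_measure_def by (intro INF_lower) auto
  also have "\<dots> = (\<Sum>i<card K. diam_power s (V i))"
    by (rule suminf_finite) (auto simp: V_def diam_power_def)
  also have "\<dots> \<le> (\<Sum>i<card K. ennreal (d powr s))"
  proof (rule sum_mono)
    fix i assume "i \<in> {..<card K}"
    then have "bounded (V i)" "diameter (V i) \<le> d" using U[OF fK, of i] by (auto simp: V_def)
    then show "diam_power s (V i) \<le> ennreal (d powr s)"
      using assms(3) by (auto simp: diam_power_def diameter_ge_0 intro!: ennreal_leI powr_mono2)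
  qed
  also have "\<dots> = ennreal (real (card K) * d powr s)"
    by (simp add: ennreal_mult ennreal_of_nat_eq_real_of_nat)
  finally show ?thesis .
qed

lemma powr_diameter_le_diam_power:
  assumes "bounded U" "diameter U \<le> 1" "0 \<le> s" "s \<le> \<sigma>" 
  shows "ennreal (diameter U powr \<sigma>) \<le> diam_power s U"
proof -
  have "0 \<le> diameter U" using assms by (intro diameter_ge_0)
  then show ?thesis
    using assms by (auto simp: diam_power_def intro!: ennreal_leI powr_mono' powr_le1)
qed

lemma geometric_scale:
  assumes "0 < q" "q < 1" "0 < r" "r < (1::real)"
  obtains n where "q ^ Suc n \<le> r" "r < q ^ n"
proof -
  obtain m where "q ^ m < r" using real_arch_pow_inv[OF assms(3,2)] by blast
  then have m: "q ^ m \<le> r" by simp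
  define N where "N = (LEAST n. q ^ n \<le> r)"
  have N: "q ^ N \<le> r" unfolding N_def using m by (rule LeastI)
  then obtain n where n: "N = Suc n" using assms(4) by (cases N) auto
  have "\<not> q ^ n \<le> r"
    using not_less_Least[of n "\<lambda>n. q ^ n \<le> r"] n unfolding N_def by auto
  then show ?thesis using that[of n] N n by simp
qed

text \<open>
  The error term \<open>\<epsilon>\<close> pays for sets of diameter 0, for which no comparable dyadic length exists.
\<close>

lemma dyadic_scale:
  assumes d: "0 \<le> d" "d \<le> 1 / 4" and pos: "0 < \<sigma>" "0 < \<epsilon>"
  obtains l :: nat where "1 \<le> l" "d < 1 / 2 ^ l"
    "2 powr (- \<sigma> * real l) \<le> 2 powr \<sigma> * d powr \<sigma> + \<epsilon>"
proof (cases "d = 0")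
  case True
  have "2 powr (- \<sigma>) < (1::real)" using pos by (simp add: powr_less_one)
  then obtain m where m: "(2 powr (- \<sigma>)) ^ m < \<epsilon>"
    using real_arch_pow_inv[OF pos(2)] by blast
  have "(2 powr (- \<sigma>)) ^ Suc m \<le> (2 powr (- \<sigma>)) ^ m"
    using \<open>2 powr (- \<sigma>) < 1\<close> by (intro power_decreasing) auto
  then have "2 powr (- \<sigma> * real (Suc m)) \<le> \<epsilon>"
    using m by (subst powr_powr[symmetric], subst powr_realpow) (auto simp del: power_Suc)
  then show ?thesis
    using True by (intro that[of "Suc m"]) auto
next
  case False
  then obtain l where l: "(1 / 2) ^ Suc l \<le> d" "d < (1 / 2) ^ l"
    using geometric_scale[of "1 / 2" d] d by auto
  have "l \<noteq> 0" using l(1) d(2) by (cases "l = 0") auto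
  moreover have "2 powr (- \<sigma> * real l) \<le> 2 powr \<sigma> * d powr \<sigma>"
  proof -
    have "2 powr (- \<sigma> * real l) = (2 powr (- real l)) powr \<sigma>"
      by (simp add: powr_powr mult.commute)
    also have "2 powr (- real l) = 2 * (1 / 2) ^ Suc l"
      by (simp add: powr_minus powr_realpow power_one_over field_simps)
    also have "(2 * (1 / 2) ^ Suc l) powr \<sigma> \<le> (2 * d) powr \<sigma>"
      using l(1) pos by (intro powr_mono2) auto
    finally show ?thesis using d by (simp add: powr_mult)
  qed
  ultimately show ?thesis
    using l(2) \<open>l \<noteq> 0\<close> pos by (intro that[of l]) (auto simp: power_one_over)
qed

context takagi_parameter
begin

section \<open>From slice dimensions to uniform growth\<close>

definition slice :: "real \<Rightarrow> real \<Rightarrow> (real \<times> real) set" where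
  "slice t c = {p \<in> takagi_graph lam. proj t p = c}"

definition level_set :: "real \<Rightarrow> real \<Rightarrow> real set" where
  "level_set t c = {x \<in> {0..1}. tilt t x = c}"

lemma slice_eq: "slice t c = (\<lambda>x. (x, takagi lam x)) ` level_set t c"
  by (auto simp: slice_def level_set_def takagi_graph_def proj_def tilt_def algebra_simps)

lemma compact_level_set: "compact (level_set t c)"
proof -
  have "closed ({0..1} \<inter> tilt t -` {c})"
    by (intro continuous_closed_preimage continuous_on_tilt) auto
  moreover have "level_set t c = {0..1} \<inter> ({0..1} \<inter> tilt t -` {c})"
    by (auto simp: level_set_def)
  ultimately show ?thesis
    by (metis compact_Icc compact_Int_closed)
qed

text \<open>
  Each set of an efficient cover is replaced by an open ball whose radius is a dyadic length
  comparable to its diameter; compactness leaves finitely many of them. The cover provided by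
  a smaller exponent has a \<open>\<sigma>\<close>-sum that is no larger, because all diameters are below 1.
\<close>

lemma level_set_ball_cover:
  assumes "0 < \<sigma>" and dim: "hausdorff_dim (slice t c) < ereal \<sigma>"
  obtains F :: "nat set" and l :: "nat \<Rightarrow> nat" and p :: "nat \<Rightarrow> real"
  where "finite F" "\<forall>i. 1 \<le> l i" "level_set t c \<subseteq> (\<Union>i\<in>F. ball (p i) (1 / 2 ^ l i))"
    "(\<Sum>i\<in>F. 2 powr (- \<sigma> * real (l i))) \<le> 1 / 8"
proof -
  obtain s where s: "0 \<le> s" "s < \<sigma>" "hausdorff_measure s (slice t c) = 0"
    using hausdorff_dim_lessE[OF dim] .
  \<comment> \<open>chosen such that \<open>2 powr \<sigma> * \<eta> + \<eta> * 2 = 1 / 8\<close>\<close>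
  define \<eta> where "\<eta> = 1 / (8 * (2 powr \<sigma> + 2))"
  have \<eta>: "0 < \<eta>" by (simp add: \<eta>_def add_pos_pos)
  obtain U where U: "slice t c \<subseteq> (\<Union>i. U i)" "\<And>i. bounded (U i)"
    "\<And>i. diameter (U i) \<le> 1 / 4" "(\<Sum>i. diam_power s (U i)) < ennreal \<eta>"
    using hausdorff_null_cover[OF s(3) _ \<eta>, of "1 / 4"] by auto
  have "\<exists>l\<ge>1. diameter (U i) < 1 / 2 ^ l \<and>
      2 powr (- \<sigma> * real l) \<le> 2 powr \<sigma> * diameter (U i) powr \<sigma> + \<eta> * (1 / 2) ^ i" for i
    using dyadic_scale[OF diameter_ge_0[OF U(2)] U(3) assms(1), of "\<eta> * (1 / 2) ^ i"] \<eta>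
    by (metis divide_pos_pos mult_pos_pos zero_less_numeral zero_less_one zero_less_power)
  then obtain l where l: "\<And>i. 1 \<le> l i" "\<And>i. diameter (U i) < 1 / 2 ^ l i"
    "\<And>i. 2 powr (- \<sigma> * real (l i)) \<le> 2 powr \<sigma> * diameter (U i) powr \<sigma> + \<eta> * (1 / 2) ^ i"
    by metis
  define p where "p i = fst (SOME z. z \<in> U i)" for i
  have "level_set t c \<subseteq> (\<Union>i. ball (p i) (1 / 2 ^ l i))"
  proof
    fix x assume "x \<in> level_set t c"
    then have "(x, takagi lam x) \<in> slice t c" by (auto simp: slice_eq)
    then obtain i where i: "(x, takagi lam x) \<in> U i" using U(1) by blast
    then have "(SOME z. z \<in> U i) \<in> U i" by (rule someI)
    then have "dist (SOME z. z \<in> U i) (x, takagi lam x) \<le> diameter (U i)"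
      using i U(2) by (intro diameter_bounded_bound)
    then have "dist (p i) x \<le> diameter (U i)"
      unfolding p_def using dist_fst_le[of "SOME z. z \<in> U i" "(x, takagi lam x)"] by simp
    then show "x \<in> (\<Union>i. ball (p i) (1 / 2 ^ l i))"
      using l(2)[of i] by (auto intro!: exI[of _ i])
  qed
  then obtain F where F: "finite F" "level_set t c \<subseteq> (\<Union>i\<in>F. ball (p i) (1 / 2 ^ l i))"
    using compactE_image[OF compact_level_set, of UNIV "\<lambda>i. ball (p i) (1 / 2 ^ l i)" t c]
    by auto
  have sum_d: "(\<Sum>i\<in>F. diameter (U i) powr \<sigma>) \<le> \<eta>"
  proof -
    have "ennreal (\<Sum>i\<in>F. diameter (U i) powr \<sigma>) = (\<Sum>i\<in>F. ennreal (diameter (U i) powr \<sigma>))"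
      by (simp add: sum_ennreal)
    also have "\<dots> \<le> (\<Sum>i\<in>F. diam_power s (U i))"
    proof (rule sum_mono)
      fix i
      show "ennreal (diameter (U i) powr \<sigma>) \<le> diam_power s (U i)"
        using U(2,3)[of i] s by (intro powr_diameter_le_diam_power) auto
    qed
    also have "\<dots> \<le> (\<Sum>i. diam_power s (U i))"
      by (intro sum_le_suminf F(1)) auto
    also have "\<dots> < ennreal \<eta>" by (rule U(4))
    finally show ?thesis using \<eta> by (simp add: ennreal_less_iff sum_nonneg)
  qed
  have sum_g: "(\<Sum>i\<in>F. (1 / 2 :: real) ^ i) \<le> 2"
  proof -
    have "(\<Sum>i\<in>F. (1 / 2 :: real) ^ i) \<le> (\<Sum>i. (1 / 2) ^ i)"
      using F(1) by (intro sum_le_suminf summable_geometric) auto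
    also have "\<dots> = 2" by (simp add: suminf_geometric)
    finally show ?thesis .
  qed
  have "(\<Sum>i\<in>F. 2 powr (- \<sigma> * real (l i))) \<le>
      (\<Sum>i\<in>F. 2 powr \<sigma> * diameter (U i) powr \<sigma> + \<eta> * (1 / 2) ^ i)"
    by (intro sum_mono l(3))
  also have "\<dots> = 2 powr \<sigma> * (\<Sum>i\<in>F. diameter (U i) powr \<sigma>) + \<eta> * (\<Sum>i\<in>F. (1 / 2) ^ i)"
    by (simp add: sum.distrib sum_distrib_left)
  also have "\<dots> \<le> 2 powr \<sigma> * \<eta> + \<eta> * 2"
    using sum_d sum_g \<eta> by (intro add_mono mult_left_mono) auto
  also have "\<dots> = (2 powr \<sigma> + 2) * \<eta>" by (simp add: algebra_simps)
  also have "\<dots> = 1 / 8"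
  proof -
    have "0 < 2 powr \<sigma> + 2" by (simp add: add_pos_pos)
    then show ?thesis by (simp add: \<eta>_def)
  qed
  finally show ?thesis using that[of F l p] F l(1) by blast
qed

text \<open>
  Off \<open>V\<close> the distance of \<open>tilt t x\<close> from \<open>c\<close> is bounded below by compactness, and a small change of
  \<open>t\<close> and \<open>c\<close> moves this distance only a little.
\<close>

lemma level_set_upper_semicontinuous:
  assumes V: "open V" "level_set t c \<subseteq> V"
  obtains e where "0 < e"
    "\<And>t' c'. \<lbrakk>\<bar>t' - t\<bar> < e; \<bar>c' - c\<bar> < e\<rbrakk> \<Longrightarrow> level_set t' c' \<subseteq> V"
proof (cases "{0..1} - V = {}")
  case True
  then have "level_set t' c' \<subseteq> V" for t' c' by (auto simp: level_set_def)
  then show ?thesis using that[of 1] by simp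
next
  case False
  have "compact ({0..1} - V)"
    using V(1) by (intro compact_diff) auto
  moreover have "continuous_on ({0..1} - V) (\<lambda>x. \<bar>tilt t x - c\<bar>)"
    by (intro continuous_intros continuous_on_tilt)
  ultimately obtain z where z: "z \<in> {0..1} - V"
    "\<And>x. x \<in> {0..1} - V \<Longrightarrow> \<bar>tilt t z - c\<bar> \<le> \<bar>tilt t x - c\<bar>"
    using continuous_attains_inf[OF _ False] by blast
  define e where "e = \<bar>tilt t z - c\<bar> / 2"
  have "0 < e" using z(1) V(2) by (auto simp: e_def level_set_def)
  moreover have "level_set t' c' \<subseteq> V" if near: "\<bar>t' - t\<bar> < e" "\<bar>c' - c\<bar> < e" for t' c'
  proof
    fix x assume x: "x \<in> level_set t' c'"
    show "x \<in> V"
    proof (rule ccontr)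
      assume "x \<notin> V"
      then have "2 * e \<le> \<bar>tilt t x - c\<bar>"
        using z(2)[of x] x by (auto simp: e_def level_set_def)
      moreover have "tilt t x - c = (c' - c) - (t' - t) * x"
        using x by (auto simp: level_set_def tilt_def algebra_simps)
      moreover have "\<bar>(t' - t) * x\<bar> \<le> \<bar>t' - t\<bar> * 1"
        unfolding abs_mult using x by (intro mult_left_mono) (auto simp: level_set_def)
      ultimately show False
        using near abs_triangle_ineq4[of "c' - c" "(t' - t) * x"] by simp
    qed
  qed
  ultimately show ?thesis using that by blast
qed

text \<open>
  \<open>W\<close> is a finite family of pairs (level, index) of dyadic intervals covering the level set. The sum is
  at most 1/2 rather than 1 so that the exponent can still be lowered by \<open>1 / L\<close>: this costs at most
  a factor 2 on intervals of level at most \<open>L\<close>.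
\<close>

definition coverable :: "real \<Rightarrow> nat \<Rightarrow> real \<Rightarrow> real \<Rightarrow> bool" where
  "coverable \<sigma> L t c \<longleftrightarrow> (\<exists>W. finite W \<and> (\<forall>(l, k)\<in>W. 1 \<le> l \<and> l \<le> L) \<and>
     (\<forall>x\<in>level_set t c. \<exists>l. \<forall>k<2 ^ l. x \<in> dyadic l k \<longrightarrow> (l, k) \<in> W) \<and>
     (\<Sum>(l, k)\<in>W. 2 powr (- \<sigma> * real l)) \<le> 1 / 2)"

lemma coverable_mono:
  assumes "coverable \<sigma> L t c" "L \<le> L'"
  shows "coverable \<sigma> L' t c"
proof -
  obtain W where W: "finite W" "\<forall>(l, k)\<in>W. 1 \<le> l \<and> l \<le> L"
     "\<forall>x\<in>level_set t c. \<exists>l. \<forall>k<2 ^ l. x \<in> dyadic l k \<longrightarrow> (l, k) \<in> W"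
     "(\<Sum>(l, k)\<in>W. 2 powr (- \<sigma> * real l)) \<le> 1 / 2"
    using assms(1) unfolding coverable_def by blast
  have "\<forall>(l, k)\<in>W. 1 \<le> l \<and> l \<le> L'" using W(2) assms(2) by fastforce
  then show ?thesis unfolding coverable_def using W by blast
qed

lemma coverable_locally:
  assumes "0 < \<sigma>" "hausdorff_dim (slice t c) < ereal \<sigma>"
  obtains e L where "0 < e"
    "\<And>t' c'. \<lbrakk>\<bar>t' - t\<bar> < e; \<bar>c' - c\<bar> < e\<rbrakk> \<Longrightarrow> coverable \<sigma> L t' c'"
proof -
  obtain F :: "nat set" and l :: "nat \<Rightarrow> nat" and p :: "nat \<Rightarrow> real" where F: "finite F" "\<forall>i. 1 \<le> l i"
    "level_set t c \<subseteq> (\<Union>i\<in>F. ball (p i) (1 / 2 ^ l i))"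
    "(\<Sum>i\<in>F. 2 powr (- \<sigma> * real (l i))) \<le> 1 / 8"
    using level_set_ball_cover[OF assms] .
  define V where "V = (\<Union>i\<in>F. ball (p i) (1 / 2 ^ l i))"
  have "open V" "level_set t c \<subseteq> V" unfolding V_def using F(3) by auto
  then obtain e where e: "0 < e"
    "\<And>t' c'. \<lbrakk>\<bar>t' - t\<bar> < e; \<bar>c' - c\<bar> < e\<rbrakk> \<Longrightarrow> level_set t' c' \<subseteq> V"
    using level_set_upper_semicontinuous[of V t c] by blast
  define K where "K i = {k. dyadic (l i) k \<inter> ball (p i) (1 / 2 ^ l i) \<noteq> {}}" for i
  have K: "finite (K i)" "card (K i) \<le> 4" for i
    unfolding K_def by (rule card_dyadic_meeting_ball)+
  \<comment> \<open>an open ball of dyadic radius meets at most four closed dyadic intervals of that length,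
    which turns the bound 1/8 into 1/2\<close>
  define W where "W = (\<Union>i\<in>F. Pair (l i) ` K i)"
  have "finite W" unfolding W_def using F(1) K by auto
  moreover have "\<forall>(l', k)\<in>W. 1 \<le> l' \<and> l' \<le> Max (l ` F)"
  proof clarify
    fix l' k assume "(l', k) \<in> W"
    then obtain i where "i \<in> F" "l' = l i" unfolding W_def by blast
    then show "1 \<le> l' \<and> l' \<le> Max (l ` F)" using F(1,2) by simp
  qed
  moreover have "\<exists>l. \<forall>k<2 ^ l. x \<in> dyadic l k \<longrightarrow> (l, k) \<in> W" if "x \<in> V" for x
  proof -
    from that obtain i where "i \<in> F" "x \<in> ball (p i) (1 / 2 ^ l i)" unfolding V_def by blast
    then show ?thesis unfolding W_def K_def by (intro exI[of _ "l i"]) blast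
  qed
  moreover have "(\<Sum>(l, k)\<in>W. 2 powr (- \<sigma> * real l)) \<le> 1 / 2"
  proof -
    have "W = (\<lambda>(i, k). (l i, k)) ` Sigma F K" unfolding W_def by auto
    moreover have "finite (Sigma F K)" using F(1) K by auto
    ultimately have "(\<Sum>(l, k)\<in>W. 2 powr (- \<sigma> * real l)) \<le>
        (\<Sum>(i, k)\<in>Sigma F K. 2 powr (- \<sigma> * real (l i)))"
      using sum_image_le[of "Sigma F K" "\<lambda>(l, k). 2 powr (- \<sigma> * real l)" "\<lambda>(i, k). (l i, k)"]
      by (simp add: case_prod_unfold comp_def)
    also have "\<dots> = (\<Sum>i\<in>F. real (card (K i)) * 2 powr (- \<sigma> * real (l i)))"
      using F(1) K by (subst sum.Sigma[symmetric]) auto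
    also have "\<dots> \<le> (\<Sum>i\<in>F. 4 * 2 powr (- \<sigma> * real (l i)))"
      using K by (intro sum_mono mult_right_mono) auto
    also have "\<dots> \<le> 1 / 2" using F(4) by (simp flip: sum_distrib_left)
    finally show ?thesis .
  qed
  ultimately have "coverable \<sigma> (Max (l ` F)) t' c'" if "\<bar>t' - t\<bar> < e" "\<bar>c' - c\<bar> < e" for t' c'
    unfolding coverable_def using e(2)[OF that] by (intro exI[of _ W]) blast
  then show ?thesis using that e(1) by blast
qed

text \<open>
  The parameters \<open>(t, c)\<close> of nonempty level sets with \<open>\<bar>t\<bar> \<le> R\<close> form a bounded set, so finitely many
  of the neighbourhoods from \<open>coverable_locally\<close> suffice.
\<close>

lemma coverable_uniformly:
  assumes "0 < \<sigma>" and dim: "\<And>t c. hausdorff_dim (slice t c) < ereal \<sigma>"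
  obtains L where "\<And>t c. \<bar>t\<bar> \<le> R \<Longrightarrow> coverable \<sigma> L t c"
proof -
  define C where "C = 1 / (1 - lam) + R"
  have "\<forall>q. \<exists>e L. 0 < e \<and> (\<forall>t' c'. \<bar>t' - fst q\<bar> < e \<longrightarrow> \<bar>c' - snd q\<bar> < e \<longrightarrow> coverable \<sigma> L t' c')"
  proof
    fix q :: "real \<times> real"
    obtain e L where "0 < e"
      "\<And>t' c'. \<lbrakk>\<bar>t' - fst q\<bar> < e; \<bar>c' - snd q\<bar> < e\<rbrakk> \<Longrightarrow> coverable \<sigma> L t' c'"
      using coverable_locally[OF assms(1) dim, of "fst q" "snd q"] by metis
    then show "\<exists>e L. 0 < e \<and>
        (\<forall>t' c'. \<bar>t' - fst q\<bar> < e \<longrightarrow> \<bar>c' - snd q\<bar> < e \<longrightarrow> coverable \<sigma> L t' c')"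
      by blast
  qed
  then obtain e L where e: "\<And>q. 0 < e q" and
    L: "\<And>q t' c'. \<lbrakk>\<bar>t' - fst q\<bar> < e q; \<bar>c' - snd q\<bar> < e q\<rbrakk> \<Longrightarrow> coverable \<sigma> (L q) t' c'"
    by metis
  have "compact ({-R..R} \<times> {-C..C})" by (intro compact_Times) auto
  moreover have "{-R..R} \<times> {-C..C} \<subseteq> (\<Union>q\<in>UNIV. ball q (e q))"
    using e by (auto intro!: exI centre_in_ball[THEN iffD2])
  ultimately obtain Q where Q: "finite Q" "{-R..R} \<times> {-C..C} \<subseteq> (\<Union>q\<in>Q. ball q (e q))"
    using compactE_image[of "{-R..R} \<times> {-C..C}" UNIV "\<lambda>q. ball q (e q)"] by auto
  have "coverable \<sigma> (Max (L ` Q)) t c" if t: "\<bar>t\<bar> \<le> R" for t c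
  proof (cases "\<bar>c\<bar> \<le> C")
    case True
    then have "(t, c) \<in> {-R..R} \<times> {-C..C}" using t by auto
    then obtain q where q: "q \<in> Q" "dist q (t, c) < e q" using Q(2) by force
    have "\<bar>t - fst q\<bar> < e q" "\<bar>c - snd q\<bar> < e q"
      using dist_fst_le[of q "(t, c)"] dist_snd_le[of q "(t, c)"] q(2)
      by (auto simp: dist_real_def)
    then have "coverable \<sigma> (L q) t c" by (rule L)
    then show ?thesis using Q(1) q(1) by (auto elim!: coverable_mono)
  next
    case False
    have "level_set t c = {}"
    proof -
      have "\<bar>tilt t x\<bar> \<le> C" if "x \<in> {0..1}" for x
      proof -
        have "\<bar>t * x\<bar> \<le> R * 1" unfolding abs_mult using t that by (intro mult_mono) auto
        then show ?thesis
          using takagi_nonneg[of x] takagi_le[of x] by (simp add: tilt_def C_def)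
      qed
      then show ?thesis using False by (auto simp: level_set_def)
    qed
    then show ?thesis unfolding coverable_def by (intro exI[of _ "{}"]) auto
  qed
  then show ?thesis using that by blast
qed

text \<open>
  Induction on \<open>n\<close>: the intervals of a cover have levels \<open>l\<close> between 1 and \<open>L\<close>, and inside each of them
  the claim for \<open>n - l\<close> applies to a rescaled level set. The weights
  \<open>2 powr (- \<tau> * l)\<close> sum to at most 1, so the constant does not deteriorate. For \<open>n < L\<close> the trivial
  bound \<open>2 ^ n\<close> suffices, which is where the constant \<open>2 ^ L\<close> comes from.
\<close>

lemma card_hits_le_powr_if_coverable:
  assumes R: "1 / (2 * lam - 1) \<le> R" and L: "1 \<le> L"
    and cov: "\<And>t c. \<bar>t\<bar> \<le> R \<Longrightarrow> coverable \<sigma> L t c"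
    and \<tau>: "0 \<le> \<tau>" "\<sigma> - 1 / real L \<le> \<tau>" and t: "\<bar>t\<bar> \<le> R"
  shows "real (card (hits t {c} n)) \<le> 2 ^ L * 2 powr (\<tau> * real n)"
  using t
proof (induction n arbitrary: t c rule: less_induct)
  case (less n)
  show ?case
  proof (cases "n < L")
    case True
    have "real (card (hits t {c} n)) \<le> real (2 ^ n)"
      by (intro of_nat_mono card_hits_le)
    also have "\<dots> \<le> 2 ^ L * 1" using True by (simp add: power_increasing)
    also have "\<dots> \<le> 2 ^ L * 2 powr (\<tau> * real n)"
      using \<tau> by (intro mult_left_mono ge_one_powr_ge_zero) auto
    finally show ?thesis .
  next
    case False
    obtain W where W: "finite W" "\<forall>(l, k)\<in>W. 1 \<le> l \<and> l \<le> L"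
       "\<forall>x\<in>level_set t c. \<exists>l. \<forall>k<2 ^ l. x \<in> dyadic l k \<longrightarrow> (l, k) \<in> W"
       "(\<Sum>(l, k)\<in>W. 2 powr (- \<sigma> * real l)) \<le> 1 / 2"
      using cov[OF less.prems, of c] unfolding coverable_def by blast
    have "real (card (hits t {c} n)) \<le> (\<Sum>(l, k)\<in>W. 2 ^ L * 2 powr (\<tau> * real (n - l)))"
    proof (rule card_hits_le_sum_cover[OF R less.prems W(1)])
      show "1 \<le> l \<and> l \<le> n" if "(l, k) \<in> W" for l k
        using W(2) that False by fastforce
      show "\<exists>l. \<forall>k<2 ^ l. x \<in> dyadic l k \<longrightarrow> (l, k) \<in> W" 
        if "x \<in> {0..1}" "tilt t x = c" for x
        using W(3) that by (auto simp: level_set_def)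
    qed (use less.IH in auto)
    also have "\<dots> \<le> (\<Sum>(l, k)\<in>W. 2 ^ L * 2 powr (\<tau> * real n) * (2 * 2 powr (- \<sigma> * real l)))"
    proof (rule sum_mono, clarify)
      fix l k assume "(l, k) \<in> W"
      then have l: "1 \<le> l" "l \<le> L" "l \<le> n" using W(2) False by fastforce+
      have "\<sigma> * real l - \<tau> * real l \<le> (1 / real L) * real l"
        unfolding left_diff_distrib[symmetric] using \<tau> by (intro mult_right_mono) auto
      also have "\<dots> \<le> 1" using l L by (simp add: field_simps)
      finally have "\<tau> * real (n - l) \<le> \<tau> * real n + (1 - \<sigma> * real l)"
        using l by (simp add: of_nat_diff algebra_simps)
      then have "2 powr (\<tau> * real (n - l)) \<le> 2 powr (\<tau> * real n + (1 + - \<sigma> * real l))"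
        by (intro powr_mono) auto
      also have "\<dots> = 2 powr (\<tau> * real n) * (2 * 2 powr (- \<sigma> * real l))"
        by (simp only: powr_add powr_one zero_le_numeral)
      finally show "2 ^ L * 2 powr (\<tau> * real (n - l)) \<le>
          2 ^ L * 2 powr (\<tau> * real n) * (2 * 2 powr (- \<sigma> * real l))"
        by simp
    qed
    also have "\<dots> = 2 ^ L * 2 powr (\<tau> * real n) * (2 * (\<Sum>(l, k)\<in>W. 2 powr (- \<sigma> * real l)))"
      by (simp add: sum_distrib_left case_prod_unfold)
    also have "\<dots> \<le> 2 ^ L * 2 powr (\<tau> * real n) * 1"
      using W(4) by (intro mult_left_mono) auto
    finally show ?thesis by simp
  qed
qed

text \<open>
  Pointwise information on dimensions becomes a uniform counting bound. The strict gain \<open>\<tau> < \<sigma>\<close> is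
  needed to see that the maximal dimension of slices is attained.
\<close>

lemma card_hits_growth:
  assumes "0 < \<sigma>" and dim: "\<And>t c. hausdorff_dim (slice t c) < ereal \<sigma>"
  obtains \<tau> C where "\<tau> < \<sigma>" "0 < C"
    "\<And>t c n. \<bar>t\<bar> \<le> R \<Longrightarrow> real (card (hits t {c} n)) \<le> C * 2 powr (\<tau> * real n)"
proof -
  define R' where "R' = max R (1 / (2 * lam - 1))"
  obtain L0 where L0: "\<And>t c. \<bar>t\<bar> \<le> R' \<Longrightarrow> coverable \<sigma> L0 t c"
    using coverable_uniformly[OF assms] by blast
  define L where "L = max 1 L0"
  define \<tau> where "\<tau> = max 0 (\<sigma> - 1 / real L)"
  have L: "1 \<le> L" "L0 \<le> L" by (auto simp: L_def)
  show ?thesis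
  proof (rule that)
    show "\<tau> < \<sigma>" using assms(1) L(1) by (auto simp: \<tau>_def)
    show "0 < (2::real) ^ L" by simp
    show "real (card (hits t {c} n)) \<le> 2 ^ L * 2 powr (\<tau> * real n)" if "\<bar>t\<bar> \<le> R" for t c n
    proof (rule card_hits_le_powr_if_coverable[where R = R' and \<sigma> = \<sigma>])
      show "coverable \<sigma> L t c" if "\<bar>t\<bar> \<le> R'" for t c
        using L0[OF that] L(2) by (rule coverable_mono)
    qed (use that L(1) in \<open>auto simp: R'_def \<tau>_def\<close>)
  qed
qed

end

section \<open>Pointwise dimensions\<close>

text \<open>
  Taking logarithms reverses the inequality since \<open>ln r < 0\<close>. The conventions for measure 0 and
  infinite measure are the ones under which this holds without exception.
\<close>

lemma le_eln_ratio_iff: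
  assumes r: "0 < r" "r < 1"
  shows "ereal \<kappa> \<le> eln m / ereal (ln r) \<longleftrightarrow> m \<le> ennreal (r powr \<kappa>)"
proof (cases m)
  case (real x)
  have ln: "ln r < 0" using r by simp
  show ?thesis
  proof (cases "x = 0")
    case True
    then show ?thesis using real ln by (simp add: eln_def)
  next
    case False
    then have x: "0 < x" using real by simp
    have "ereal \<kappa> \<le> eln m / ereal (ln r) \<longleftrightarrow> \<kappa> \<le> ln x / ln r"
      using real x ln by (simp add: eln_def)
    also have "\<dots> \<longleftrightarrow> ln x \<le> \<kappa> * ln r"
      using ln by (simp add: neg_le_divide_eq)
    also have "\<dots> \<longleftrightarrow> x \<le> r powr \<kappa>"
      using x r exp_le_cancel_iff[of "ln x" "\<kappa> * ln r"] by (simp add: powr_def)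
    also have "\<dots> \<longleftrightarrow> m \<le> ennreal (r powr \<kappa>)"
      using real by (simp add: ennreal_le_iff)
    finally show ?thesis .
  qed
next
  case top
  have "ln r < 0" using r by simp
  then show ?thesis using top by (simp add: eln_def top_unique)
qed

lemma one_le_lower_local_dimI:
  assumes "\<And>\<kappa>. \<lbrakk>0 < \<kappa>; \<kappa> < 1\<rbrakk> \<Longrightarrow>
    \<exists>C>0. \<forall>r. 0 < r \<longrightarrow> r < 1 \<longrightarrow> emeasure \<mu> (cball x r) \<le> ennreal (C * r powr \<kappa>)"
  shows "1 \<le> lower_local_dim \<mu> x"
proof (rule dense_le)
  fix y :: ereal assume "y < 1"
  then obtain \<kappa> where \<kappa>: "0 < \<kappa>" "\<kappa> < 1" "y \<le> ereal \<kappa>"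
  proof (cases y)
    case (real v)
    then show ?thesis using \<open>y < 1\<close> by (intro that[of "max (1 / 2) v"]) (auto simp: one_ereal_def)
  qed (auto intro: that[of "1 / 2"])
  define \<theta> where "\<theta> = (1 + \<kappa>) / 2"
  have \<theta>: "\<kappa> < \<theta>" "0 < \<theta>" "\<theta> < 1" using \<kappa> by (auto simp: \<theta>_def)
  obtain C where C: "0 < C" 
    "\<And>r. \<lbrakk>0 < r; r < 1\<rbrakk> \<Longrightarrow> emeasure \<mu> (cball x r) \<le> ennreal (C * r powr \<theta>)"
    using assms[OF \<theta>(2,3)] by auto
  \<comment> \<open>below this radius the factor \<open>r powr (\<theta> - \<kappa>)\<close> absorbs the constant \<open>C\<close>\<close>
  define b where "b = min 1 ((1 / C) powr (1 / (\<theta> - \<kappa>)))"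
  have "0 < b" using C(1) by (simp add: b_def)
  have "ereal \<kappa> \<le> eln (emeasure \<mu> (cball x r)) / ereal (ln r)" if r: "0 < r" "r < b" for r
  proof -
    have r1: "r < 1" using r by (simp add: b_def)
    have "r powr (\<theta> - \<kappa>) \<le> ((1 / C) powr (1 / (\<theta> - \<kappa>))) powr (\<theta> - \<kappa>)"
      using r \<theta> by (intro powr_mono2) (auto simp: b_def)
    also have "\<dots> = 1 / C" using C(1) \<theta> by (simp add: powr_powr)
    finally have "C * r powr (\<theta> - \<kappa>) \<le> 1" using C(1) by (simp add: field_simps)
    then have "C * r powr (\<theta> - \<kappa>) * r powr \<kappa> \<le> 1 * r powr \<kappa>"
      by (intro mult_right_mono) auto
    then have "C * r powr \<theta> \<le> r powr \<kappa>"
      by (simp add: mult.assoc flip: powr_add)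
    then have "emeasure \<mu> (cball x r) \<le> ennreal (r powr \<kappa>)"
      using C(2)[OF r(1) r1] by (meson ennreal_leI order_trans)
    then show ?thesis using le_eln_ratio_iff[OF r(1) r1] by blast
  qed
  then have "eventually (\<lambda>r. ereal \<kappa> \<le> eln (emeasure \<mu> (cball x r)) / ereal (ln r)) (at_right 0)"
    unfolding eventually_at_right_field using \<open>0 < b\<close> by (intro exI[of _ b]) auto
  then have "ereal \<kappa> \<le> lower_local_dim \<mu> x"
    unfolding lower_local_dim_def by (rule Liminf_bounded)
  with \<kappa>(3) show "y \<le> lower_local_dim \<mu> x" by (rule order_trans)
qed

lemma upper_local_dim_small_ball:
  assumes dim: "1 \<le> upper_local_dim \<mu> x" and "\<kappa> < 1" "0 < b"
  shows "\<exists>r>0. r < b \<and> emeasure \<mu> (cball x r) \<le> ennreal (r powr \<kappa>)"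
proof (rule ccontr)
  assume no: "\<not> (\<exists>r>0. r < b \<and> emeasure \<mu> (cball x r) \<le> ennreal (r powr \<kappa>))"
  have "eln (emeasure \<mu> (cball x r)) / ereal (ln r) \<le> ereal \<kappa>" if r: "0 < r" "r < min b 1" for r
  proof -
    have "\<not> emeasure \<mu> (cball x r) \<le> ennreal (r powr \<kappa>)" using no r by auto
    then show ?thesis using le_eln_ratio_iff[of r \<kappa>] r by (metis linear min_less_iff_conj)
  qed
  then have "eventually (\<lambda>r. eln (emeasure \<mu> (cball x r)) / ereal (ln r) \<le> ereal \<kappa>) (at_right 0)"
    unfolding eventually_at_right_field using assms(3) by (intro exI[of _ "min b 1"]) auto
  then have "upper_local_dim \<mu> x \<le> ereal \<kappa>"
    unfolding upper_local_dim_def by (rule Limsup_bounded)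
  then have "1 \<le> ereal \<kappa>" using dim by (rule order_trans[rotated])
  then show False using assms(2) by simp
qed

lemma lower_local_dim_le_upper: "lower_local_dim \<mu> x \<le> upper_local_dim \<mu> x"
  unfolding lower_local_dim_def upper_local_dim_def by (intro Liminf_le_Limsup) simp

context takagi_parameter
begin

section \<open>Projections of the length measure\<close>

definition projected :: "real \<Rightarrow> real measure" where
  "projected t = distr (takagi_measure lam) borel (proj t)"

lemma emeasure_projected_cball:
  "emeasure (projected t) (cball c r) = emeasure lebesgue {x \<in> {0..1}. \<bar>tilt t x - c\<bar> \<le> r}"
proof -
  let ?L = "lebesgue_on {0..1::real}"
  have g: "(\<lambda>x. (x, takagi lam x)) \<in> measurable ?L borel"
    by (intro continuous_imp_measurable_on_sets_lebesgue continuous_on_Pair continuous_on_id 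
        continuous_on_takagi) auto
  have p: "proj t \<in> measurable borel borel"
    unfolding proj_def[abs_def] by measurable
  have "projected t = distr ?L borel (proj t \<circ> (\<lambda>x. (x, takagi lam x)))"
    unfolding projected_def takagi_measure_def by (rule distr_distr[OF p g])
  also have "proj t \<circ> (\<lambda>x. (x, takagi lam x)) = tilt t"
    by (auto simp: proj_def tilt_def algebra_simps)
  finally have eq: "projected t = distr ?L borel (tilt t)" .
  have meas: "tilt t \<in> measurable ?L borel"
    by (intro continuous_imp_measurable_on_sets_lebesgue continuous_on_tilt) auto
  have "emeasure (projected t) (cball c r) = emeasure ?L (tilt t -` cball c r \<inter> space ?L)"
    unfolding eq by (rule emeasure_distr[OF meas]) auto
  also have "tilt t -` cball c r \<inter> space ?L = {x \<in> {0..1}. \<bar>tilt t x - c\<bar> \<le> r}"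
    by (auto simp: dist_real_def abs_minus_commute)
  also have "emeasure ?L {x \<in> {0..1}. \<bar>tilt t x - c\<bar> \<le> r} = emeasure lebesgue {x \<in> {0..1}. \<bar>tilt t x - c\<bar> \<le> r}"
    by (rule emeasure_restrict_space) auto
  finally show ?thesis .
qed

lemma sets_tilt_near: "{x \<in> {0..1}. \<bar>tilt t x - c\<bar> \<le> r} \<in> sets lebesgue"
proof -
  have "{x \<in> {0..1}. \<bar>tilt t x - c\<bar> \<le> r} = {0..1} \<inter> tilt t -` cball c r"
    by (auto simp: dist_real_def abs_minus_commute)
  moreover have "closed ({0..1} \<inter> tilt t -` cball c r)"
    by (intro continuous_closed_preimage continuous_on_tilt) auto
  ultimately show ?thesis by (metis borel_closed sets_completionI_sets sets_lborel)
qed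

lemma emeasure_dyadic: "emeasure lebesgue (dyadic n k) = ennreal (1 / 2 ^ n)"
proof -
  have "(real k + 1) / 2 ^ n - real k / 2 ^ n = 1 / 2 ^ n" by (simp add: field_simps)
  moreover have "real k / 2 ^ n \<le> (real k + 1) / 2 ^ n" by (simp add: divide_right_mono)
  ultimately show ?thesis by (simp add: dyadic_eq)
qed

lemma emeasure_projected_le:
  assumes M: "\<And>c. real (card (hits t {c} n)) \<le> M" and r: "0 \<le> r"
  shows "emeasure (projected t) (cball c r) \<le> ennreal ((4 * r / lam ^ n + 3) * M / 2 ^ n)"
proof -
  let ?K = "hits t {c - r..c + r} n"
  have "{x \<in> {0..1}. \<bar>tilt t x - c\<bar> \<le> r} \<subseteq> (\<Union>k\<in>?K. dyadic n k)"
  proof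
    fix x assume x: "x \<in> {x \<in> {0..1}. \<bar>tilt t x - c\<bar> \<le> r}"
    then obtain k where k: "k < 2 ^ n" "x \<in> dyadic n k" using unit_in_dyadic[of x n] by blast
    have "tilt t x \<in> tilt t ` dyadic n k \<inter> {c - r..c + r}" using x k by (auto simp: abs_le_iff)
    then have "k \<in> ?K" using k unfolding hits_def by blast
    then show "x \<in> (\<Union>k\<in>?K. dyadic n k)" using k by blast
  qed
  then have "emeasure (projected t) (cball c r) \<le> emeasure lebesgue (\<Union>k\<in>?K. dyadic n k)"
    unfolding emeasure_projected_cball by (rule emeasure_mono) (auto simp: dyadic_eq)
  also have "\<dots> \<le> (\<Sum>k\<in>?K. emeasure lebesgue (dyadic n k))"
    by (rule emeasure_subadditive_finite) (auto simp: dyadic_eq)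
  also have "\<dots> = ennreal (real (card ?K) / 2 ^ n)"
    unfolding emeasure_dyadic
    by (simp add: ennreal_of_nat_eq_real_of_nat flip: ennreal_mult)
  also have "\<dots> \<le> ennreal ((4 * r / lam ^ n + 3) * M / 2 ^ n)"
    using card_hits_interval_le[OF M, of "c - r" "c + r"] r
    by (intro ennreal_leI divide_right_mono) auto
  finally show ?thesis .
qed

text \<open>
  On an interval that is hit, \<open>tilt t\<close> stays within its oscillation from \<open>c\<close>, so the whole interval
  lies in the preimage of the ball. Half-open intervals make the union disjoint.
\<close>

lemma card_hits_le_emeasure_projected:
  assumes R: "1 / (2 * lam - 1) \<le> R" "\<bar>t\<bar> \<le> R" and r: "lam ^ n * (1 / (1 - lam) + R) \<le> r"
  shows "ennreal (real (card (hits t {c} n)) / 2 ^ n) \<le> emeasure (projected t) (cball c r)"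
proof -
  let ?K = "hits t {c} n"
  define H where "H k = {real k / 2 ^ n ..< (real k + 1) / 2 ^ n}" for k
  have H_sub: "H k \<subseteq> dyadic n k" for k by (auto simp: H_def dyadic_eq)
  have disj: "disjoint_family_on H ?K"
  proof -
    have "k = k'" if x: "x \<in> H k" "x \<in> H k'" for x k k'
    proof -
      have "real k \<le> 2 ^ n * x" "2 ^ n * x < real k + 1" 
        "real k' \<le> 2 ^ n * x" "2 ^ n * x < real k' + 1"
        using x by (auto simp: H_def field_simps)
      then have "real k < real (k' + 1)" "real k' < real (k + 1)" by auto
      then show ?thesis unfolding of_nat_less_iff by simp
    qed
    then show ?thesis by (auto simp: disjoint_family_on_def)
  qed
  have H_meas: "emeasure lebesgue (H k) = ennreal (1 / 2 ^ n)" for k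
  proof -
    have "(real k + 1) / 2 ^ n - real k / 2 ^ n = 1 / 2 ^ n" by (simp add: field_simps)
    moreover have "real k / 2 ^ n \<le> (real k + 1) / 2 ^ n" by (simp add: divide_right_mono)
    ultimately show ?thesis by (simp add: H_def)
  qed
  have "ennreal (real (card ?K) / 2 ^ n) = (\<Sum>k\<in>?K. emeasure lebesgue (H k))"
    unfolding H_meas by (simp add: ennreal_of_nat_eq_real_of_nat flip: ennreal_mult)
  also have "\<dots> = emeasure lebesgue (\<Union>k\<in>?K. H k)"
    by (rule sum_emeasure[OF _ disj]) (auto simp: H_def)
  also have "\<dots> \<le> emeasure lebesgue {x \<in> {0..1}. \<bar>tilt t x - c\<bar> \<le> r}"
  proof (rule emeasure_mono[OF _ sets_tilt_near], rule UN_least, rule subsetI)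
    fix k x assume k: "k \<in> ?K" and x: "x \<in> H k"
    obtain y where y: "k < 2 ^ n" "y \<in> dyadic n k" "tilt t y = c" 
      using k unfolding hits_def by auto
    have "x \<in> dyadic n k" using x H_sub by blast
    then have "x \<in> {0..1}" "\<bar>tilt t x - c\<bar> \<le> lam ^ n * (1 / (1 - lam) + R)"
      using dyadic_subset_unit[OF y(1)] tilt_dyadic_oscillation_le[OF R y(1) _ y(2)] y(3) by auto
    then show "x \<in> {x \<in> {0..1}. \<bar>tilt t x - c\<bar> \<le> r}" using r by auto
  qed
  finally show ?thesis unfolding emeasure_projected_cball .
qed

text \<open>
  The growth exponent of the average of \<open>card (hits t {c} n)\<close> over \<open>c\<close>: there are \<open>2 ^ n\<close> pieces of
  height about \<open>lam ^ n\<close>, and \<open>2 powr typical_dim = 2 * lam\<close>.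
\<close>

definition typical_dim :: real where
  "typical_dim = 1 - ln lam / ln (1 / 2)"

lemma typical_dim_eq: "typical_dim = 1 + ln lam / ln 2"
  by (simp add: typical_dim_def ln_div)

lemma typical_dim_pos: "0 < typical_dim" and typical_dim_less_1: "typical_dim < 1"
proof -
  have "ln (1 / 2) < ln lam" using lam_gt_half lam_pos by (subst ln_less_cancel_iff) auto
  then have "- 1 < ln lam / ln 2" by (simp add: ln_div pos_less_divide_eq)
  then show "0 < typical_dim" by (simp add: typical_dim_eq)
  have "ln lam < 0" using lam_less_1 by simp
  then have "ln lam / ln 2 < 0" by (intro divide_neg_pos) auto
  then show "typical_dim < 1" by (simp add: typical_dim_eq)
qed

lemma typical_dim_less_scaled: "\<kappa> < 1 \<Longrightarrow> typical_dim < 1 + \<kappa> * (typical_dim - 1)"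
  using mult_pos_neg[of "1 - \<kappa>" "typical_dim - 1"] typical_dim_less_1 by (simp add: algebra_simps)

text \<open>
  Dictionary between the two sides: a measure of order \<open>r powr \<kappa>\<close> at radius \<open>r = lam ^ n\<close> corresponds to
  \<open>(2 * lam powr \<kappa>) ^ n\<close> dyadic intervals, that is, to the covering exponent \<open>1 + \<kappa> * (typical_dim - 1)\<close>.
\<close>

lemma two_powr_typical_dim: "2 powr (1 + \<kappa> * (typical_dim - 1)) = 2 * lam powr \<kappa>"
proof -
  have "2 powr (\<kappa> * (typical_dim - 1)) = lam powr \<kappa>"
    using lam_pos by (simp add: typical_dim_eq powr_def del: lam_pos)
  then show ?thesis by (simp add: powr_add)
qed

text \<open>
  The exponent \<open>\<sigma>\<close> that belongs to \<open>\<kappa> < 1\<close> exceeds \<open>typical_dim\<close>, so all slices have dimension below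
  \<open>\<sigma>\<close> and \<open>card_hits_growth\<close> applies. It bounds the number of hits uniformly in the level, which is
  needed because a ball of radius \<open>r\<close> involves all levels near \<open>c\<close>.
\<close>

lemma lower_local_dim_projected_ge_1:
  assumes slices: "\<And>t c. hausdorff_dim (slice t c) \<le> ereal typical_dim"
  shows "1 \<le> lower_local_dim (projected t) c"
proof (rule one_le_lower_local_dimI)
  fix \<kappa> :: real assume \<kappa>: "0 < \<kappa>" "\<kappa> < 1"
  define \<sigma> where "\<sigma> = 1 + \<kappa> * (typical_dim - 1)"
  have \<sigma>: "typical_dim < \<sigma>" using typical_dim_less_scaled[OF \<kappa>(2)] by (simp add: \<sigma>_def)
  then have "0 < \<sigma>" using typical_dim_pos by linarith
  moreover have "hausdorff_dim (slice t c) < ereal \<sigma>" for t c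
    using slices[of t c] \<sigma> by (meson ereal_less_eq(3) le_less_trans less_ereal.simps(1))
  ultimately obtain \<tau> C where \<tau>: "\<tau> < \<sigma>" and C: "0 < C" 
    "\<And>t' c n. \<bar>t'\<bar> \<le> \<bar>t\<bar> \<Longrightarrow> real (card (hits t' {c} n)) \<le> C * 2 powr (\<tau> * real n)"
    using card_hits_growth[of \<sigma> "\<bar>t\<bar>"] by blast
  have bound: "real (card (hits t {c} n)) \<le> C * (2 * lam powr \<kappa>) ^ n" for c n
  proof -
    have "real (card (hits t {c} n)) \<le> C * 2 powr (\<tau> * real n)" by (intro C) simp
    also have "\<dots> \<le> C * 2 powr (\<sigma> * real n)"
      using C(1) \<tau> by (intro mult_left_mono powr_mono mult_right_mono) auto
    also have "2 powr (\<sigma> * real n) = (2 * lam powr \<kappa>) ^ n"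
      unfolding \<sigma>_def two_powr_typical_dim[symmetric] by (simp add: powr_powr flip: powr_realpow)
    finally show ?thesis .
  qed
  define D where "D = 7 * C / lam powr \<kappa>"
  have "emeasure (projected t) (cball c r) \<le> ennreal (D * r powr \<kappa>)" if r: "0 < r" "r < 1" for r
  proof -
    obtain n where n: "lam ^ Suc n \<le> r" "r < lam ^ n"
      using geometric_scale[OF lam_pos lam_less_1 r] .
    have "emeasure (projected t) (cball c r) \<le>
        ennreal ((4 * r / lam ^ n + 3) * (C * (2 * lam powr \<kappa>) ^ n) / 2 ^ n)"
      using bound r by (intro emeasure_projected_le) auto
    also have "\<dots> \<le> ennreal (7 * C * (lam powr \<kappa>) ^ n)"
    proof (rule ennreal_leI)
      have "4 * r / lam ^ n + 3 \<le> 7" using n(2) by (simp add: field_simps)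
      then have "(4 * r / lam ^ n + 3) * (C * (lam powr \<kappa>) ^ n) \<le> 7 * (C * (lam powr \<kappa>) ^ n)"
        using C(1) by (intro mult_right_mono) auto
      then show "(4 * r / lam ^ n + 3) * (C * (2 * lam powr \<kappa>) ^ n) / 2 ^ n \<le> 7 * C * (lam powr \<kappa>) ^ n"
        by (simp add: power_mult_distrib mult.assoc)
    qed
    also have "7 * C * (lam powr \<kappa>) ^ n = D * (lam ^ Suc n) powr \<kappa>"
    proof -
      have "(lam ^ Suc n) powr \<kappa> = lam powr \<kappa> * (lam powr \<kappa>) ^ n"
        by (simp add: powr_powr powr_add powr_mult mult.commute flip: powr_realpow)
      then show ?thesis by (simp add: D_def)
    qed
    also have "ennreal \<dots> \<le> ennreal (D * r powr \<kappa>)"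
      using n(1) C(1) \<kappa> by (intro ennreal_leI mult_left_mono powr_mono2) (auto simp: D_def)
    finally show ?thesis .
  qed
  moreover have "0 < D" using C(1) by (simp add: D_def)
  ultimately show "\<exists>C>0. \<forall>r. 0 < r \<longrightarrow> r < 1 \<longrightarrow>
      emeasure (projected t) (cball c r) \<le> ennreal (C * r powr \<kappa>)"
    by blast
qed

lemma hausdorff_pre_measure_slice_le:
  assumes "0 < \<sigma>" "(1 + \<bar>t\<bar>) / 2 ^ n \<le> \<delta>"
  shows "hausdorff_pre_measure \<sigma> \<delta> (slice t c) \<le>
    ennreal (real (card (hits t {c} n)) * ((1 + \<bar>t\<bar>) / 2 ^ n) powr \<sigma>)"
proof (rule hausdorff_pre_measure_le_finite)
  define U where "U k = (\<lambda>x. (x, c - t * x)) ` dyadic n k" for k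
  show "slice t c \<subseteq> (\<Union>k\<in>hits t {c} n. U k)"
  proof
    fix z assume "z \<in> slice t c"
    then obtain x where x: "x \<in> {0..1}" "tilt t x = c" "z = (x, takagi lam x)"
      by (auto simp: slice_eq level_set_def)
    obtain k where k: "k < 2 ^ n" "x \<in> dyadic n k" using unit_in_dyadic[OF x(1)] .
    have "k \<in> hits t {c} n" using k x(2) unfolding hits_def by blast
    moreover have "z = (x, c - t * x)" using x by (auto simp: tilt_def)
    ultimately show "z \<in> (\<Union>k\<in>hits t {c} n. U k)" using k(2) by (auto simp: U_def)
  qed
  show "bounded (U k) \<and> diameter (U k) \<le> (1 + \<bar>t\<bar>) / 2 ^ n" for k
  proof
    have "compact (U k)"
      unfolding U_def dyadic_eq by (intro compact_continuous_image continuous_intros) simp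
    then show "bounded (U k)" by (rule compact_imp_bounded)
    show "diameter (U k) \<le> (1 + \<bar>t\<bar>) / 2 ^ n"
    proof (rule diameter_le)
      fix z w assume "z \<in> U k" "w \<in> U k"
      then obtain x y where xy: "x \<in> dyadic n k" "y \<in> dyadic n k"
        "z = (x, c - t * x)" "w = (y, c - t * y)" by (auto simp: U_def)
      have "(real k + 1) / 2 ^ n - real k / 2 ^ n = 1 / 2 ^ n" by (simp add: field_simps)
      then have "\<bar>x - y\<bar> \<le> 1 / 2 ^ n" using xy(1,2) by (auto simp: dyadic_eq abs_le_iff)
      have "norm (z - w) = norm (x - y, t * (y - x))" using xy(3,4) by (simp add: algebra_simps)
      also have "\<dots> \<le> \<bar>x - y\<bar> + \<bar>t * (y - x)\<bar>" using norm_Pair_le[of "x - y" "t * (y - x)"] by simp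
      also have "\<bar>t * (y - x)\<bar> = \<bar>t\<bar> * \<bar>x - y\<bar>" by (simp only: abs_mult abs_minus_commute)
      also have "\<bar>x - y\<bar> + \<bar>t\<bar> * \<bar>x - y\<bar> = (1 + \<bar>t\<bar>) * \<bar>x - y\<bar>" by (simp only: distrib_right mult_1)
      also have "\<dots> \<le> (1 + \<bar>t\<bar>) * (1 / 2 ^ n)"
        using \<open>\<bar>x - y\<bar> \<le> 1 / 2 ^ n\<close> by (intro mult_left_mono) auto
      finally show "norm (z - w) \<le> (1 + \<bar>t\<bar>) / 2 ^ n" by simp
    qed simp
  qed
qed (use assms in auto)

text \<open>
  Take \<open>\<kappa> < \<theta> < 1\<close>. A single scale \<open>r\<close> at which the ball about \<open>c\<close> has measure at most \<open>r powr \<theta>\<close> yields a cover of the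
  slice by few intervals of length \<open>2 ^ - n\<close>, where \<open>lam ^ n\<close> is comparable to \<open>r\<close>. Its sum for the exponent
  belonging to \<open>\<kappa>\<close> is of order \<open>r powr (\<theta> - \<kappa>)\<close>. Arbitrarily small such scales exist
  already when the upper pointwise dimension is at least 1.
\<close>

lemma hausdorff_dim_slice_le_typical_dim:
  assumes dim: "1 \<le> upper_local_dim (projected t) c"
  shows "hausdorff_dim (slice t c) \<le> ereal typical_dim"
proof -
  have main: "hausdorff_dim (slice t c) \<le> ereal (1 + \<kappa> * (typical_dim - 1))" if \<kappa>: "0 < \<kappa>" "\<kappa> < 1" for \<kappa>
  proof -
    define \<sigma> where "\<sigma> = 1 + \<kappa> * (typical_dim - 1)"
    have \<sigma>: "0 < \<sigma>" using typical_dim_less_scaled[OF \<kappa>(2)] typical_dim_pos by (simp add: \<sigma>_def)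
    define \<theta> where "\<theta> = (1 + \<kappa>) / 2"
    have \<theta>: "\<kappa> < \<theta>" "\<theta> < 1" using \<kappa> by (auto simp: \<theta>_def)
    define R where "R = \<bar>t\<bar> + 1 / (2 * lam - 1)"
    have R: "1 / (2 * lam - 1) \<le> R" "\<bar>t\<bar> \<le> R" using lam_gt_half by (auto simp: R_def)
    define B where "B = 1 / (1 - lam) + R"
    have B: "0 < B" using lam_less_1 R by (auto simp: B_def intro!: add_pos_nonneg)
    define D where "D = 1 + \<bar>t\<bar>"
    have D: "0 < D" by (simp add: D_def)
    define E where "E = (B / lam) powr \<theta> * D powr \<sigma> / B powr (\<theta> - \<kappa>)"
    have E: "0 < E" using B D by (auto simp: E_def intro!: divide_pos_pos mult_pos_pos)
    have "hausdorff_pre_measure \<sigma> \<delta> (slice t c) \<le> ennreal \<epsilon>" if "0 < \<delta>" "0 < \<epsilon>" for \<delta> \<epsilon>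
    proof -
      \<comment> \<open>the three bounds make the scale \<open>n\<close> exist, the covering sets smaller than \<open>\<delta>\<close>, and the sum
        smaller than \<open>\<epsilon>\<close>\<close>
      define b where "b = min (min B (\<delta> * B / D)) ((\<epsilon> / E) powr (1 / (\<theta> - \<kappa>)))"
      have "0 < b" using that B D E by (simp add: b_def)
      then obtain r where r: "0 < r" "r < b"
        "emeasure (projected t) (cball c r) \<le> ennreal (r powr \<theta>)"
        using upper_local_dim_small_ball[OF dim \<theta>(2)] by blast
      have rb: "r < B" "r * D < \<delta> * B" "r < (\<epsilon> / E) powr (1 / (\<theta> - \<kappa>))"
        using r(2) D by (auto simp: b_def field_simps)
      obtain m where m: "lam ^ Suc m \<le> r / B" "r / B < lam ^ m"
        using geometric_scale[OF lam_pos lam_less_1, of "r / B"] r(1) rb(1) B by auto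
      define n where "n = Suc m"
      have n: "lam ^ n * B \<le> r" "r < lam ^ n * (B / lam)"
        using m B by (auto simp: n_def field_simps)
      define N where "N = real (card (hits t {c} n))"
      have "ennreal (N / 2 ^ n) \<le> ennreal (r powr \<theta>)"
        using card_hits_le_emeasure_projected[OF R n(1)[unfolded B_def], of c] r(3)
        unfolding N_def by (rule order_trans)
      then have "N / 2 ^ n \<le> r powr \<theta>" by (simp add: ennreal_le_iff)
      also have "\<dots> \<le> (lam ^ n * (B / lam)) powr \<theta>"
        using n(2) r(1) \<theta> \<kappa> by (intro powr_mono2) auto
      also have "\<dots> = (lam ^ n) powr \<theta> * (B / lam) powr \<theta>"
        by (rule powr_mult)
      finally have N: "N \<le> 2 ^ n * ((lam ^ n) powr \<theta> * (B / lam) powr \<theta>)"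
        by (simp add: field_simps)
      have two: "(2 ^ n) powr \<sigma> = 2 ^ n * (lam ^ n) powr \<kappa>"
      proof -
        have "(2 ^ n) powr \<sigma> = (2 powr \<sigma>) ^ n"
          by (simp add: powr_powr mult.commute flip: powr_realpow)
        also have "\<dots> = 2 ^ n * (lam powr \<kappa>) ^ n"
          unfolding \<sigma>_def two_powr_typical_dim by (simp add: power_mult_distrib)
        also have "(lam powr \<kappa>) ^ n = (lam ^ n) powr \<kappa>"
          by (simp add: powr_powr mult.commute flip: powr_realpow)
        finally show ?thesis .
      qed
      have "N * (D / 2 ^ n) powr \<sigma> \<le> 
          2 ^ n * ((lam ^ n) powr \<theta> * (B / lam) powr \<theta>) * (D / 2 ^ n) powr \<sigma>"
        using N by (intro mult_right_mono) auto
      also have "\<dots> = (B / lam) powr \<theta> * D powr \<sigma> * ((lam ^ n) powr \<theta> / (lam ^ n) powr \<kappa>)"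
        using D by (simp add: powr_divide two)
      also have "(lam ^ n) powr \<theta> / (lam ^ n) powr \<kappa> = (lam ^ n) powr (\<theta> - \<kappa>)"
        by (simp add: powr_diff)
      also have "(B / lam) powr \<theta> * D powr \<sigma> * (lam ^ n) powr (\<theta> - \<kappa>) \<le>
          (B / lam) powr \<theta> * D powr \<sigma> * (r / B) powr (\<theta> - \<kappa>)"
        using n(1) \<theta> B by (intro mult_left_mono powr_mono2) (auto simp: field_simps)
      also have "\<dots> = E * r powr (\<theta> - \<kappa>)"
        using B r(1) by (simp add: E_def powr_divide)
      also have "\<dots> \<le> E * ((\<epsilon> / E) powr (1 / (\<theta> - \<kappa>))) powr (\<theta> - \<kappa>)"
        using E rb(3) r(1) \<theta> by (intro mult_left_mono powr_mono2) auto
      also have "\<dots> = \<epsilon>" using E \<theta> that by (simp add: powr_powr)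
      finally have small: "N * (D / 2 ^ n) powr \<sigma> \<le> \<epsilon>" .
      have "D / 2 ^ n \<le> \<delta>"
      proof -
        have "D / 2 ^ n = D * (1 / 2) ^ n" by (simp add: power_one_over)
        also have "\<dots> \<le> D * lam ^ n" using D lam_gt_half by (intro mult_left_mono power_mono) auto
        also have "\<dots> \<le> D * (r / B)" using D B n(1) by (intro mult_left_mono) (auto simp: field_simps)
        also have "\<dots> \<le> \<delta>" using rb(2) B by (simp add: field_simps)
        finally show ?thesis .
      qed
      then have "hausdorff_pre_measure \<sigma> \<delta> (slice t c) \<le> ennreal (N * (D / 2 ^ n) powr \<sigma>)"
        unfolding N_def D_def by (intro hausdorff_pre_measure_slice_le \<sigma>)
      also have "\<dots> \<le> ennreal \<epsilon>" using small by (rule ennreal_leI)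
      finally show ?thesis .
    qed
    then have "hausdorff_pre_measure \<sigma> \<delta> (slice t c) = 0" if "0 < \<delta>" for \<delta>
      using that by (metis ennreal_le_epsilon add_0 le_zero_eq)
    then have "hausdorff_measure \<sigma> (slice t c) = 0"
      unfolding hausdorff_measure_def by (simp add: SUP_eq_const)
    then show ?thesis
      using \<sigma> unfolding \<sigma>_def by (intro hausdorff_dim_leI) auto
  qed
  show ?thesis
  proof (rule dense_ge)
    fix y assume y: "ereal typical_dim < y"
    show "hausdorff_dim (slice t c) \<le> y"
    proof (cases y)
      case (real v)
      then have v: "typical_dim < v" using y by simp
      define \<kappa> where "\<kappa> = max (1 / 2) (1 - (v - typical_dim) / (1 - typical_dim))"
      have \<kappa>: "0 < \<kappa>" "\<kappa> < 1" using v typical_dim_less_1 by (auto simp: \<kappa>_def)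
      have "(1 - (v - typical_dim) / (1 - typical_dim)) * (1 - typical_dim) \<le> \<kappa> * (1 - typical_dim)"
        using typical_dim_less_1 by (intro mult_right_mono) (auto simp: \<kappa>_def)
      moreover have "(1 - (v - typical_dim) / (1 - typical_dim)) * (1 - typical_dim) = 1 - v"
      proof -
        have "(v - typical_dim) / (1 - typical_dim) * (1 - typical_dim) = v - typical_dim" using typical_dim_less_1 by simp
        then show ?thesis by (simp only: left_diff_distrib) simp
      qed
      ultimately have "1 + \<kappa> * (typical_dim - 1) \<le> v"
        by (simp add: algebra_simps)
      then show ?thesis using main[OF \<kappa>] real by (meson ereal_less_eq(3) order_trans)
    qed (use y in auto)
  qed
qed

end

section \<open>Planar slices and the equivalence\<close>

lemma hausdorff_dim_finite_le_0:
  assumes A: "finite A"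
  shows "hausdorff_dim A \<le> 0"
proof (rule dense_ge)
  fix y :: ereal assume y: "0 < y"
  show "hausdorff_dim A \<le> y"
  proof (cases y)
    case (real v)
    then have v: "0 < v" using y by simp
    have "hausdorff_pre_measure v \<delta> A = 0" if "0 < \<delta>" for \<delta>
      using hausdorff_pre_measure_le_finite[where A = A and K = A and U = "\<lambda>x. {x}" and s = v and \<delta> = \<delta> and d = 0] A v that by simp
    then have "hausdorff_measure v A = 0"
      unfolding hausdorff_measure_def by (simp add: SUP_eq_const)
    then show ?thesis using hausdorff_dim_leI[of v A] v real by simp
  qed (use y in auto)
qed

text \<open>
  Lines in the plane are hyperplanes; those with a normal vector \<open>(p, q)\<close>, \<open>q \<noteq> 0\<close>, are the kernels of
  \<open>proj (p / q)\<close>.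
\<close>

lemma RP1_cases:
  assumes "V \<in> RP1"
  obtains t where "V = {v. proj t v = 0}" | "V = {v. fst v = 0}"
proof -
  have V: "subspace V" "dim V = DIM(real \<times> real) - 1" using assms by (auto simp: RP1_def)
  then obtain a where a: "a \<noteq> 0" "span V = {v. a \<bullet> v = 0}"
    using dim_eq_hyperplane[of V] by blast
  then have Va: "V = {v. a \<bullet> v = 0}" using span_eq_iff[of V] V(1) by simp
  obtain p q where pq: "a = (p, q)" by force
  show ?thesis
  proof (cases "q = 0")
    case True
    then show ?thesis using a(1) Va pq by (intro that(2)) (auto simp: zero_prod_def)
  next
    case False
    have "V = {v. proj (p / q) v = 0}"
      unfolding Va pq using False by (auto simp: proj_def field_simps)
    then show ?thesis by (rule that(1))
  qed
qed

lemma proj_kernel_in_RP1: "{v. proj t v = 0} \<in> RP1"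
proof -
  have eq: "{v. proj t v = 0} = {v. (t, 1) \<bullet> v = 0}" by (simp add: proj_def inner_commute)
  have "dim {v. (t, 1::real) \<bullet> v = 0} = DIM(real \<times> real) - 1"
    by (rule dim_hyperplane) (simp add: zero_prod_def)
  then show ?thesis
    unfolding eq RP1_def by (simp add: subspace_hyperplane)
qed

context takagi_parameter
begin

lemma graph_Int_proj_kernel:
  "takagi_graph lam \<inter> (\<lambda>v. v + x) ` {v. proj t v = 0} = slice t (proj t x)"
proof -
  have "(\<lambda>v. v + x) ` {v. proj t v = 0} = {p. proj t p = proj t x}"
  proof (intro equalityI subsetI)
    fix p assume "p \<in> {p. proj t p = proj t x}"
    then show "p \<in> (\<lambda>v. v + x) ` {v. proj t v = 0}"
      by (intro image_eqI[of _ _ "p - x"]) (auto simp: proj_def inner_diff_left)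
  qed (auto simp: proj_def inner_add_left)
  then show ?thesis by (auto simp: slice_def)
qed

definition slice_dims :: "ereal set" where
  "slice_dims = {hausdorff_dim (takagi_graph lam \<inter> (\<lambda>v. v + x) ` V) | x V.
     x \<in> takagi_graph lam \<and> V \<in> RP1}"

lemma hausdorff_dim_slice_in_slice_dims:
  assumes "slice t c \<noteq> {}"
  shows "hausdorff_dim (slice t c) \<in> slice_dims"
proof -
  obtain x where "x \<in> takagi_graph lam" "proj t x = c" using assms by (auto simp: slice_def)
  then show ?thesis
    unfolding slice_dims_def using graph_Int_proj_kernel[of x t] proj_kernel_in_RP1[of t]
    by (intro CollectI exI[of _ x] exI[of _ "{v. proj t v = 0}"]) simp
qed

text \<open>
  A vertical line meets a graph in one point, so it contributes dimension 0.
\<close>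

lemma slice_dims_cases:
  assumes "d \<in> slice_dims"
  obtains t x where "x \<in> takagi_graph lam" "d = hausdorff_dim (slice t (proj t x))" | "d \<le> 0"
proof -
  obtain x V where x: "x \<in> takagi_graph lam" and V: "V \<in> RP1"
    and d: "d = hausdorff_dim (takagi_graph lam \<inter> (\<lambda>v. v + x) ` V)"
    using assms by (auto simp: slice_dims_def)
  show ?thesis
    using V
  proof (cases rule: RP1_cases)
    case (1 t)
    then show ?thesis using that(1)[OF x, of t] d graph_Int_proj_kernel by simp
  next
    case 2
    have sub: "takagi_graph lam \<inter> (\<lambda>v. v + x) ` V \<subseteq> {x}"
      using x by (auto simp: 2 takagi_graph_def)
    have "d \<le> 0"
      unfolding d by (rule hausdorff_dim_finite_le_0, rule finite_subset[OF sub]) simp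
    then show ?thesis by (rule that(2))
  qed
qed

text \<open>
  By \<open>card_hits_lower_bound\<close> the number \<open>2 ^ n * lam ^ n = 2 powr (typical_dim * n)\<close> is at most a constant
  times the bound for the hits.
\<close>

lemma typical_dim_le_exponent_if_card_hits_le:
  assumes C: "\<And>c n. real (card (hits 0 {c} n)) \<le> C * 2 powr (\<tau> * real n)"
  shows "typical_dim \<le> \<tau>"
proof (rule ccontr)
  assume "\<not> typical_dim \<le> \<tau>"
  define q where "q = 2 powr (typical_dim - \<tau>)"
  have "1 < q" using \<open>\<not> typical_dim \<le> \<tau>\<close> by (simp add: q_def)
  define E where "E = (2 / (1 - lam) + 3) * C"
  have "q ^ n \<le> E" for n
  proof -
    have C0: "0 \<le> C * 2 powr (\<tau> * real n)" 
      using C[of 0 n] by linarith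
    have "lam ^ n * 3 \<le> 1 * 3" using lam_less_1 by (intro mult_right_mono power_le_one) auto
    then have fac: "lam ^ n * (2 / (1 - lam) / lam ^ n + 3) \<le> 2 / (1 - lam) + 3"
      by (simp add: distrib_left)
    have "(2 * lam) ^ n = lam ^ n * 2 ^ n" by (simp add: power_mult_distrib)
    also have "\<dots> \<le> lam ^ n * ((2 / (1 - lam) / lam ^ n + 3) * (C * 2 powr (\<tau> * real n)))"
      using C by (intro mult_left_mono card_hits_lower_bound) auto
    also have "\<dots> = lam ^ n * (2 / (1 - lam) / lam ^ n + 3) * (C * 2 powr (\<tau> * real n))"
      by (simp only: mult.assoc)
    also have "\<dots> \<le> (2 / (1 - lam) + 3) * (C * 2 powr (\<tau> * real n))"
      using fac C0 by (rule mult_right_mono)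
    finally have le: "(2 * lam) ^ n \<le> E * 2 powr (\<tau> * real n)" by (simp add: E_def mult.assoc)
    have "2 powr typical_dim = 2 * lam" using two_powr_typical_dim[of 1] by simp
    then have "(2 * lam) ^ n = 2 powr (typical_dim * real n)"
      by (metis powr_powr powr_realpow powr_gt_zero zero_neq_numeral)
    also have "\<dots> = q ^ n * 2 powr (\<tau> * real n)"
    proof -
      have "q ^ n = 2 powr ((typical_dim - \<tau>) * real n)"
        unfolding q_def by (metis powr_powr powr_realpow powr_gt_zero zero_neq_numeral)
      then show ?thesis by (simp add: algebra_simps flip: powr_add)
    qed
    finally have "q ^ n * 2 powr (\<tau> * real n) = (2 * lam) ^ n" ..
    then show ?thesis using le by (metis mult_le_cancel_right_pos powr_gt_zero zero_neq_numeral)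
  qed
  then show False using real_arch_pow[OF \<open>1 < q\<close>, of E] by (meson not_less)
qed

text \<open>
  Otherwise \<open>card_hits_growth\<close> with \<open>\<sigma> = typical_dim\<close> would give a growth exponent below
  \<open>typical_dim\<close>.
\<close>

lemma ex_slice_dim_ge_typical_dim: "\<exists>t c. ereal typical_dim \<le> hausdorff_dim (slice t c)"
proof (rule ccontr)
  assume "\<not> ?thesis"
  then have less: "hausdorff_dim (slice t c) < ereal typical_dim" for t c by (simp add: not_le)
  show False
  proof (rule card_hits_growth[OF typical_dim_pos less, of 0])
    fix \<tau> C :: real
    assume "\<tau> < typical_dim"
      and growth: "\<And>t c n. \<bar>t\<bar> \<le> 0 \<Longrightarrow> real (card (hits t {c} n)) \<le> C * 2 powr (\<tau> * real n)"
    have "typical_dim \<le> \<tau>" by (rule typical_dim_le_exponent_if_card_hits_le) (rule growth, simp)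
    with \<open>\<tau> < typical_dim\<close> show False by simp
  qed
qed

lemma hausdorff_dim_empty_slice: "slice t c = {} \<Longrightarrow> hausdorff_dim (slice t c) \<le> 0"
  by (simp add: hausdorff_dim_finite_le_0)

lemma slices_le_typical_dim_imp_lower_local_dim:
  assumes "is_maximum (ereal typical_dim) slice_dims"
  shows "1 \<le> lower_local_dim (projected t) c"
proof (rule lower_local_dim_projected_ge_1)
  fix t c
  show "hausdorff_dim (slice t c) \<le> ereal typical_dim"
  proof (cases "slice t c = {}")
    case True
    then have "hausdorff_dim (slice t c) \<le> ereal 0"
      using hausdorff_dim_empty_slice by (simp add: zero_ereal_def)
    also have "\<dots> \<le> ereal typical_dim" using typical_dim_pos by simp
    finally show ?thesis .
  next
    case False
    then show ?thesis 
      using assms hausdorff_dim_slice_in_slice_dims unfolding is_maximum_def by blast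
  qed
qed

lemma upper_local_dim_imp_maximum:
  assumes dim: "\<And>x t. x \<in> takagi_graph lam \<Longrightarrow> 1 \<le> upper_local_dim (projected t) (proj t x)"
  shows "is_maximum (ereal typical_dim) slice_dims"
proof -
  have le: "d \<le> ereal typical_dim" if "d \<in> slice_dims" for d
    using that
  proof (cases rule: slice_dims_cases)
    case (1 x t)
    then show ?thesis using hausdorff_dim_slice_le_typical_dim[OF dim] by simp
  next
    case 2
    also have "0 \<le> ereal typical_dim" using typical_dim_pos by simp
    finally show ?thesis .
  qed
  obtain t c where tc: "ereal typical_dim \<le> hausdorff_dim (slice t c)"
    using ex_slice_dim_ge_typical_dim by blast
  have "slice t c \<noteq> {}"
  proof
    assume "slice t c = {}"
    then have "ereal typical_dim \<le> 0" using hausdorff_dim_empty_slice tc order_trans by blast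
    then show False using typical_dim_pos by simp
  qed
  then have "hausdorff_dim (slice t c) \<in> slice_dims"
    by (rule hausdorff_dim_slice_in_slice_dims)
  moreover from this have "hausdorff_dim (slice t c) = ereal typical_dim"
    using le tc by (intro antisym)
  ultimately show ?thesis
    unfolding is_maximum_def using le by simp
qed

end

theorem theorem1p2:
  fixes lam :: real
    and dim_loc :: "real measure \<Rightarrow> real \<Rightarrow> ereal"
  assumes "1 / 2 < lam" and "lam < 1"
    and "dim_loc \<in> {lower_local_dim, upper_local_dim}"
  shows "is_maximum (ereal (1 - ln lam / ln (1 / 2)))
           {hausdorff_dim (takagi_graph lam \<inter> (\<lambda>v. v + x) ` V) | x V.
              x \<in> takagi_graph lam \<and> V \<in> RP1}
         \<longleftrightarrow> (\<forall>x \<in> takagi_graph lam. \<forall>t :: real.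
               dim_loc (distr (takagi_measure lam) borel (proj t)) (proj t x) \<ge> 1)"
proof -
  interpret takagi_parameter lam
    using assms(1,2) by unfold_locales
  have between: "lower_local_dim \<mu> c \<le> dim_loc \<mu> c" "dim_loc \<mu> c \<le> upper_local_dim \<mu> c" for \<mu> c
    using assms(3) lower_local_dim_le_upper[of \<mu> c] by auto
  show ?thesis
    unfolding slice_dims_def[symmetric] typical_dim_def[symmetric] projected_def[symmetric]
  proof
    assume "is_maximum (ereal typical_dim) slice_dims"
    then show "\<forall>x\<in>takagi_graph lam. \<forall>t. 1 \<le> dim_loc (projected t) (proj t x)"
      using slices_le_typical_dim_imp_lower_local_dim between(1) order_trans by blast
  next
    assume "\<forall>x\<in>takagi_graph lam. \<forall>t. 1 \<le> dim_loc (projected t) (proj t x)"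
    then show "is_maximum (ereal typical_dim) slice_dims"
      using between(2) order_trans by (intro upper_local_dim_imp_maximum) blast
  qed
qed

end
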